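(* Let $G$ be a Hausdorff topological group. The following are equivalent: (1) $G$ is amenable. (2) There exists $\theta \in (\tfrac12,1]$ such that for every finite subset $E \subseteq G$ and every uniform covering $\mathcal{U}$ of $G_{r}$ with $|\mathcal{U}| \leq 3$, there is a finite non-empty subset $F \subseteq G$ such that $\mu(F,gF,\mathcal{U}) \geq \theta |F|$ for all $g\in E$. (3) There exists $\theta \in (0,1]$ such that for every finite subset $E \subseteq G$ and every two-element uniform covering $\mathcal{U}$ of $G_{r}$, there exists a finite non-empty subset $F \subseteq G$ such that $\mu(gF,hF,\mathcal{U}) \geq \theta |F|$ for all $g,h\in E$.
   Context: Right uniformity: $G_r$ denotes $G$ with its right uniformity. A set $\mathcal{U}$ of subsets of $G$ is a uniform covering of $G_r$ if there is a neighborhood $U$ of the neutral element such that for every $x\in G$ the set $Ux$ is contained in some member of $\mathcal{U}$. A function $f\colon G\to\mathbb{R}$ is uniformly continuous on $G_r$ if for every $\epsilon>0$ there is an identity neighborhood $U$ with $|f(x)-f(y)|\le\epsilon$ whenever $xy^{-1}\in U$; ${\rm UC}_b(G_r)$ is the space of bounded such functions. Amenability: a mean on $G_r$ is a linear map $\nu\colon {\rm UC}_b(G_r)\to\mathbb{R}$ with $\inf_{x\in G} f(x)\le\nu(f)\le\sup_{x\in G} f(x)$ for all $f$. Put $\lambda_G(g)(x)=gx$. The topological group $G$ is amenable if there is a mean $\nu$ on $G_r$ with $\nu(f\circ\lambda_G(g))=\nu(f)$ for all $f\in{\rm UC}_b(G_r)$ and $g\in G$. Matching number: for a covering $\mathcal{U}$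 of a set $X$ and finite $E,F\subseteq X$, $\mu(E,F,\mathcal{U})$ is the maximal cardinality of the domain $D\subseteq E$ of an injective map $\phi\colon D\to F$ such that for every $x\in D$ there is $U\in\mathcal{U}$ with $\{x,\phi(x)\}\subseteq U$. *)

theory Defs
  imports "HOL-Analysis.Analysis"
begin

text \<open>
  The class \<^class>\<open>topological_group_add\<close> extends \<^class>\<open>group_add\<close>, so the group need not be
  commutative. Its operation is merely written additively: \<open>x + y\<close> stands for the product \<open>xy\<close>,
  \<open>x - y\<close> for \<open>xy\<inverse>\<close>, and \<open>0\<close> for the neutral element.
\<close>

definition identity_neighbourhood :: "'a::topological_group_add set \<Rightarrow> bool" where
  "identity_neighbourhood U \<longleftrightarrow> 0 \<in> interior U"

text \<open>The condition already makes \<open>\<U>\<close> cover the group, because \<open>x \<in> Ux\<close>.\<close>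

definition right_uniform_covering :: "'a::topological_group_add set set \<Rightarrow> bool" where
  "right_uniform_covering \<U> \<longleftrightarrow>
     (\<exists>U. identity_neighbourhood U \<and> (\<forall>x. \<exists>V\<in>\<U>. (\<lambda>u. u + x) ` U \<subseteq> V))"

definition right_uniformly_continuous :: "('a::topological_group_add \<Rightarrow> real) \<Rightarrow> bool" where
  "right_uniformly_continuous f \<longleftrightarrow>
     (\<forall>\<epsilon>>0. \<exists>U. identity_neighbourhood U \<and> (\<forall>x y. x - y \<in> U \<longrightarrow> \<bar>f x - f y\<bar> \<le> \<epsilon>))"

definition right_UCb :: "('a::topological_group_add \<Rightarrow> real) set" where
  "right_UCb = {f. right_uniformly_continuous f \<and> bounded (range f)}"

text \<open>
  A mean is represented by a function on all of \<^typ>\<open>'a \<Rightarrow> real\<close>, of which only the restriction to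
  \<^const>\<open>right_UCb\<close> is constrained.
\<close>

definition right_mean :: "(('a::topological_group_add \<Rightarrow> real) \<Rightarrow> real) \<Rightarrow> bool" where
  "right_mean \<nu> \<longleftrightarrow>
     (\<forall>f\<in>right_UCb. \<forall>g\<in>right_UCb. \<nu> (\<lambda>x. f x + g x) = \<nu> f + \<nu> g) \<and>
     (\<forall>c. \<forall>f\<in>right_UCb. \<nu> (\<lambda>x. c * f x) = c * \<nu> f) \<and>
     (\<forall>f\<in>right_UCb. (INF x. f x) \<le> \<nu> f \<and> \<nu> f \<le> (SUP x. f x))"

definition amenable :: "'a::topological_group_add itself \<Rightarrow> bool" where
  "amenable G \<longleftrightarrow>
     (\<exists>\<nu> :: ('a \<Rightarrow> real) \<Rightarrow> real. right_mean \<nu> \<and>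
        (\<forall>f\<in>right_UCb. \<forall>g. \<nu> (f \<circ> (\<lambda>x. g + x)) = \<nu> f))"

text \<open>
  For finite \<open>E\<close> the set below is finite, and it contains \<open>0\<close> (take \<open>D = {}\<close>), so the maximum exists.
\<close>

definition matching_number :: "'a set \<Rightarrow> 'a set \<Rightarrow> 'a set set \<Rightarrow> nat" where
  "matching_number E F \<U> =
     Max {card D | D. D \<subseteq> E \<and>
       (\<exists>\<phi>. inj_on \<phi> D \<and> \<phi> ` D \<subseteq> F \<and> (\<forall>x\<in>D. \<exists>U\<in>\<U>. {x, \<phi> x} \<subseteq> U))}"

definition left_translate :: "'a::plus \<Rightarrow> 'a set \<Rightarrow> 'a set" where
  "left_translate g F = (\<lambda>x. g + x) ` F"

end

theory Submission
  imports Defs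
begin

text \<open>
  Both matching conditions concern one covering at a time, hence in effect one function at a time, and only a fixed
  proportion of the points, whereas amenability asks for exact invariance on all functions at
  once. The passage from the matchings to a mean rests on convolution. Pulling back a covering of \<open>[0, 1]\<close> by
  two or three overlapping intervals along a right uniformly continuous \<open>f\<close> turns a matching into the statement that
  the averages of \<open>f\<close> over translates of \<open>F\<close> differ by at most \<open>c < 1\<close>
  (\<open>contracts_averages_of_two_set_matchings\<close>, \<open>contracts_averages_of_three_set_matchings\<close>). By compactness of the
  set of means there is a mean \<open>\<nu>\<close> for which the profile \<open>g \<mapsto> \<nu> (f \<circ> \<lambda>(g))\<close> oscillates by at most \<open>c\<close> on the whole
  group. The profile is again right uniformly continuous, so the argument can be repeated for it.
  Convolving the means obtained multiplies the factors, and in the limit the profile is constant. A further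
  convolution treats one more function without spoiling those already treated, and compactness
  again gives an invariant mean (\<open>amenable_if_contracts_averages\<close>).

  Conversely, let \<open>\<nu>\<close> be an invariant mean on an infinite group. A greedy choice of points produces large finite sets
  \<open>F\<close> whose averages are close to \<open>\<nu>\<close> on any finite set of functions (\<open>equidistributed_sets\<close>); the points can be
  kept distinct since bump functions at single points have arbitrarily small mean (\<open>small_mean_bump\<close>). Apply this
  to the translates of a partition of unity subordinate to a covering by three sets. Two of the three functions
  have means with sum at least \<open>2/3\<close>, and all translates of \<open>F\<close> have about the same number of points to offer
  to the two corresponding sets; matching those points gives \<open>\<theta> = 3/5\<close> in both conditions
  (\<open>matchings_of_amenable\<close>). A finite group is itself invariant under translation.
\<close>

section \<open>Right uniformly continuous functions\<close>

lemma identity_neighbourhood_iff_eventually: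
  "identity_neighbourhood U \<longleftrightarrow> (\<forall>\<^sub>F u in nhds 0. u \<in> U)"
  unfolding identity_neighbourhood_def eventually_nhds interior_def by blast

lemma zero_in_identity_neighbourhood: "identity_neighbourhood U \<Longrightarrow> 0 \<in> U"
  unfolding identity_neighbourhood_def using interior_subset by blast

lemma right_UCb_iff:
  "f \<in> right_UCb \<longleftrightarrow>
     (\<forall>\<epsilon>>0. \<forall>\<^sub>F u in nhds 0. \<forall>y. \<bar>f (u + y) - f y\<bar> \<le> \<epsilon>) \<and> (\<exists>B. \<forall>x. \<bar>f x\<bar> \<le> B)"
proof -
  have "(\<exists>U. identity_neighbourhood U \<and> (\<forall>x y. x - y \<in> U \<longrightarrow> \<bar>f x - f y\<bar> \<le> \<epsilon>)) \<longleftrightarrow>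
        (\<forall>\<^sub>F u in nhds 0. \<forall>y. \<bar>f (u + y) - f y\<bar> \<le> \<epsilon>)" (is "?L \<longleftrightarrow> ?R") for \<epsilon>
  proof
    assume ?L
    then obtain U where U: "\<forall>\<^sub>F u in nhds 0. u \<in> U" "\<And>x y. x - y \<in> U \<Longrightarrow> \<bar>f x - f y\<bar> \<le> \<epsilon>"
      by (auto simp: identity_neighbourhood_iff_eventually)
    show ?R
      using U(1) by eventually_elim (use U(2) in simp)
  next
    assume R: ?R
    let ?U = "{u. \<forall>y. \<bar>f (u + y) - f y\<bar> \<le> \<epsilon>}"
    have "identity_neighbourhood ?U"
      using R by (simp add: identity_neighbourhood_iff_eventually)
    moreover have "\<bar>f x - f y\<bar> \<le> \<epsilon>" if "x - y \<in> ?U" for x y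
      using that by (force dest: spec[of _ y])
    ultimately show ?L by blast
  qed
  then show ?thesis
    by (auto simp: right_UCb_def right_uniformly_continuous_def bounded_iff)
qed

lemma right_UCb_oscillation:
  "f \<in> right_UCb \<Longrightarrow> \<epsilon> > 0 \<Longrightarrow> \<forall>\<^sub>F u in nhds 0. \<forall>y. \<bar>f (u + y) - f y\<bar> \<le> \<epsilon>"
  by (simp add: right_UCb_iff)

lemma right_UCb_bound:
  assumes "f \<in> right_UCb" obtains B where "B \<ge> 0" "\<And>x. \<bar>f x\<bar> \<le> B"
  using assms unfolding right_UCb_iff by (metis abs_ge_zero order_trans)

lemma right_UCb_const: "(\<lambda>_. c) \<in> right_UCb"
  by (auto simp: right_UCb_iff)

lemma right_UCb_add:
  assumes f: "f \<in> right_UCb" and g: "g \<in> right_UCb"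
  shows "(\<lambda>x. f x + g x) \<in> right_UCb"
  unfolding right_UCb_iff
proof (intro conjI allI impI)
  fix \<epsilon> :: real assume "\<epsilon> > 0"
  then have e: "\<epsilon>/2 > 0" by simp
  show "\<forall>\<^sub>F u in nhds 0. \<forall>y. \<bar>f (u + y) + g (u + y) - (f y + g y)\<bar> \<le> \<epsilon>"
    using right_UCb_oscillation[OF f e] right_UCb_oscillation[OF g e]
  proof eventually_elim
    case (elim u)
    have "\<bar>f (u + y) + g (u + y) - (f y + g y)\<bar> \<le> \<epsilon>" for y
      using elim[rule_format, of y] by linarith
    then show ?case by blast
  qed
next
  obtain B C where "\<And>x. \<bar>f x\<bar> \<le> B" "\<And>x. \<bar>g x\<bar> \<le> C"
    using right_UCb_bound[OF f] right_UCb_bound[OF g] by metis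
  then have "\<bar>f x + g x\<bar> \<le> B + C" for x by (meson abs_triangle_ineq add_mono order_trans)
  then show "\<exists>B. \<forall>x. \<bar>f x + g x\<bar> \<le> B" by blast
qed

lemma right_UCb_scale:
  assumes f: "f \<in> right_UCb"
  shows "(\<lambda>x. c * f x) \<in> right_UCb"
  unfolding right_UCb_iff
proof (intro conjI allI impI)
  fix \<epsilon> :: real assume "\<epsilon> > 0"
  then have e: "\<epsilon> / (\<bar>c\<bar> + 1) > 0" by simp
  show "\<forall>\<^sub>F u in nhds 0. \<forall>y. \<bar>c * f (u + y) - c * f y\<bar> \<le> \<epsilon>"
    using right_UCb_oscillation[OF f e]
  proof eventually_elim
    case (elim u)
    have "\<bar>c * f (u + y) - c * f y\<bar> \<le> \<epsilon>" for y
    proof -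
      have "\<bar>c * f (u + y) - c * f y\<bar> = \<bar>c\<bar> * \<bar>f (u + y) - f y\<bar>"
        by (simp add: abs_mult flip: right_diff_distrib)
      also have "\<dots> \<le> (\<bar>c\<bar> + 1) * (\<epsilon> / (\<bar>c\<bar> + 1))"
        using elim by (intro mult_mono) auto
      finally show ?thesis by simp
    qed
    then show ?case by blast
  qed
next
  obtain B where "\<And>x. \<bar>f x\<bar> \<le> B" using right_UCb_bound[OF f] by metis
  then have "\<bar>c * f x\<bar> \<le> \<bar>c\<bar> * B" for x by (simp add: abs_mult mult_left_mono)
  then show "\<exists>B. \<forall>x. \<bar>c * f x\<bar> \<le> B" by blast
qed

lemma right_UCb_diff:
  assumes "f \<in> right_UCb" "g \<in> right_UCb" shows "(\<lambda>x. f x - g x) \<in> right_UCb"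
  using right_UCb_add[OF assms(1) right_UCb_scale[OF assms(2), of "-1"]] by simp

lemma right_UCb_sum:
  assumes "\<And>i. i \<in> I \<Longrightarrow> f i \<in> right_UCb"
  shows "(\<lambda>x. \<Sum>i\<in>I. f i x) \<in> right_UCb"
  using assms
  by (induction I rule: infinite_finite_induct) (auto intro: right_UCb_const right_UCb_add)

lemma right_UCb_max:
  assumes f: "f \<in> right_UCb" and g: "g \<in> right_UCb"
  shows "(\<lambda>x. max (f x) (g x)) \<in> right_UCb"
  unfolding right_UCb_iff
proof (intro conjI allI impI)
  fix \<epsilon> :: real assume e: "\<epsilon> > 0"
  show "\<forall>\<^sub>F u in nhds 0. \<forall>y. \<bar>max (f (u + y)) (g (u + y)) - max (f y) (g y)\<bar> \<le> \<epsilon>"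
    using right_UCb_oscillation[OF f e] right_UCb_oscillation[OF g e]
  proof eventually_elim
    case (elim u)
    have "\<bar>max (f (u + y)) (g (u + y)) - max (f y) (g y)\<bar> \<le> \<epsilon>" for y
      using elim[rule_format, of y] by linarith
    then show ?case by blast
  qed
next
  obtain B C where BC: "\<And>x. \<bar>f x\<bar> \<le> B" "\<And>x. \<bar>g x\<bar> \<le> C"
    using right_UCb_bound[OF f] right_UCb_bound[OF g] by metis
  have "\<bar>max (f x) (g x)\<bar> \<le> max B C" for x using BC[of x] by linarith
  then show "\<exists>B. \<forall>x. \<bar>max (f x) (g x)\<bar> \<le> B" by blast
qed

text \<open>
  Left translation conjugates the increment: \<open>g + (u + y) = (g + u - g) + (g + y)\<close>, so uniformity
  survives because conjugation by \<open>g\<close> is continuous at the neutral element.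
\<close>

lemma right_UCb_left_translate:
  fixes f :: "'a::topological_group_add \<Rightarrow> real"
  assumes f: "f \<in> right_UCb"
  shows "(\<lambda>x. f (g + x)) \<in> right_UCb"
  unfolding right_UCb_iff
proof (intro conjI allI impI)
  fix \<epsilon> :: real assume e: "\<epsilon> > 0"
  have "((\<lambda>u. g + u - g) \<longlongrightarrow> g + 0 - g) (nhds 0)"
    by (intro tendsto_intros filterlim_ident)
  then have "filterlim (\<lambda>u. g + u - g) (nhds 0) (nhds 0)" by simp
  from eventually_compose_filterlim[OF right_UCb_oscillation[OF f e] this]
  show "\<forall>\<^sub>F u in nhds 0. \<forall>y. \<bar>f (g + (u + y)) - f (g + y)\<bar> \<le> \<epsilon>"
  proof eventually_elim
    case (elim u)
    have "g + (u + y) = g + u - g + (g + y)" for y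
      by (metis add.assoc diff_add_cancel)
    then show ?case using elim by metis
  qed
next
  show "\<exists>B. \<forall>x. \<bar>f (g + x)\<bar> \<le> B" using right_UCb_bound[OF f] by metis
qed

section \<open>Right uniformly continuous bump functions\<close>

text \<open>
  Bump functions come from a Birkhoff--Kakutani construction. For neighbourhoods \<open>V 0, V 1, \<dots>\<close> of
  the neutral element with \<open>V (n+1) + V (n+1) + V (n+1) \<subseteq> V n\<close>, a list of indices prescribes a product of
  the corresponding neighbourhoods and has the weight \<open>\<Sum>n. (1/2) ^ n\<close> over its entries; the infimum of the
  weights of the lists whose product contains \<open>x\<close> is a subadditive gauge of \<open>x\<close>.
\<close>

fun chain_sum :: "(nat \<Rightarrow> 'a::monoid_add set) \<Rightarrow> nat list \<Rightarrow> 'a set" where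
  "chain_sum V [] = {0}"
| "chain_sum V (n # ns) = {v + w | v w. v \<in> V n \<and> w \<in> chain_sum V ns}"

abbreviation weight :: "nat list \<Rightarrow> real" where
  "weight ns \<equiv> \<Sum>n\<leftarrow>ns. (1/2) ^ n"

lemma chain_sum_append:
  "x \<in> chain_sum V (ms @ ns) \<longleftrightarrow> (\<exists>v\<in>chain_sum V ms. \<exists>w\<in>chain_sum V ns. x = v + w)"
  by (induction ms arbitrary: x) (force simp: add.assoc)+

lemma weight_nonneg: "weight ns \<ge> 0"
  by (induction ns) auto

text \<open>
  The distinguished entry \<open>n\<close> is the one at which the partial sums of the weights cross half of the
  total weight.
\<close>

lemma balanced_split:
  assumes "ns \<noteq> []"
  shows "\<exists>as n bs. ns = as @ n # bs \<and> weight as \<le> weight ns / 2 \<and> weight bs \<le> weight ns / 2"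
proof -
  have "\<exists>as n bs. ns = as @ n # bs \<and> weight as \<le> t \<and> t \<le> weight as + (1/2) ^ n"
    if "ns \<noteq> []" "0 \<le> t" "t \<le> weight ns" for ns t
    using that
  proof (induction ns arbitrary: t)
    case (Cons m ns)
    show ?case
    proof (cases "ns = [] \<or> t \<le> (1/2) ^ m")
      case True
      then show ?thesis using Cons.prems by (intro exI[of _ "[]"]) auto
    next
      case False
      then obtain as n bs where "ns = as @ n # bs" "weight as \<le> t - (1/2) ^ m"
          "t - (1/2) ^ m \<le> weight as + (1/2) ^ n"
        using Cons.IH[of "t - (1/2) ^ m"] Cons.prems by auto
      then show ?thesis by (intro exI[of _ "m # as"] exI[of _ n] exI[of _ bs]) auto
    qed
  qed simp
  from this[OF assms, of "weight ns / 2"] weight_nonneg[of ns]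
  obtain as n bs where "ns = as @ n # bs" "weight as \<le> weight ns / 2"
      "weight ns / 2 \<le> weight as + (1/2) ^ n" by auto
  then show ?thesis by (intro exI[of _ as] exI[of _ n] exI[of _ bs]) auto
qed

text \<open>
  A nonempty list of weight below \<open>(1/2) ^ m\<close> splits into two lists of weight below \<open>(1/2) ^ (m+1)\<close> and one
  entry \<open>n > m\<close> between them. By induction each of the three parts stays in \<open>V (m+1)\<close>, and the
  hypothesis on triple sums brings the whole back into \<open>V m\<close>. This is why triple sums are needed
  in place of double ones.
\<close>

lemma chain_sum_subset:
  fixes V :: "nat \<Rightarrow> 'a::monoid_add set"
  assumes zero: "\<And>n. 0 \<in> V n"
    and tri: "\<And>n u v w. u \<in> V (Suc n) \<Longrightarrow> v \<in> V (Suc n) \<Longrightarrow> w \<in> V (Suc n) \<Longrightarrow> u + v + w \<in> V n"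
    and "weight ns < (1/2) ^ m"
  shows "chain_sum V ns \<subseteq> V m"
  using assms(3)
proof (induction "length ns" arbitrary: ns m rule: less_induct)
  case less
  have anti: "V n \<subseteq> V k" if "k \<le> n" for k n
    using that by (rule lift_Suc_antimono_le[rotated]) (use tri zero in force)
  show ?case
  proof (cases "ns = []")
    case True
    then show ?thesis by (simp add: zero)
  next
    case False
    then obtain as n bs where ns: "ns = as @ n # bs"
      and as: "weight as \<le> weight ns / 2" and bs: "weight bs \<le> weight ns / 2"
      using balanced_split by blast
    have "chain_sum V as \<subseteq> V (Suc m)" "chain_sum V bs \<subseteq> V (Suc m)"
      using less as bs by (auto simp: ns)
    moreover have "V n \<subseteq> V (Suc m)"
    proof -
      have "weight as + ((1/2) ^ n + weight bs) < (1/2) ^ m"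
        using less.prems by (simp add: ns)
      then have "(1/2::real) ^ n < (1/2) ^ m"
        using weight_nonneg[of as] weight_nonneg[of bs] by linarith
      then have "m < n" by (subst (asm) power_strict_decreasing_iff) auto
      then show ?thesis by (intro anti) simp
    qed
    ultimately show ?thesis
      unfolding ns by (auto simp: chain_sum_append) (metis add.assoc subsetD tri)
  qed
qed

lemma neighbourhood_triple_sum:
  assumes "\<forall>\<^sub>F x in nhds (0::'a::topological_monoid_add). P x"
  obtains Q where "\<forall>\<^sub>F x in nhds (0::'a). Q x"
    "\<And>u v w. Q u \<Longrightarrow> Q v \<Longrightarrow> Q w \<Longrightarrow> P (u + v + w)"
proof -
  have half: "\<exists>Q. (\<forall>\<^sub>F x in nhds (0::'a). Q x) \<and> (\<forall>u v. Q u \<longrightarrow> Q v \<longrightarrow> P (u + v))"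
    if "\<forall>\<^sub>F x in nhds (0::'a). P x" for P
  proof -
    have "filterlim (\<lambda>x. fst x + snd x) (nhds (0::'a)) (nhds 0 \<times>\<^sub>F nhds 0)"
      using tendsto_add_Pair[of "0::'a" 0] by simp
    from eventually_compose_filterlim[OF that this]
    obtain Q1 Q2 where "\<forall>\<^sub>F x in nhds (0::'a). Q1 x" "\<forall>\<^sub>F x in nhds (0::'a). Q2 x"
        "\<forall>x y. Q1 x \<longrightarrow> Q2 y \<longrightarrow> P (x + y)"
      by (auto simp: eventually_prod_filter)
    then show ?thesis
      by (intro exI[of _ "\<lambda>x. Q1 x \<and> Q2 x"]) (auto intro: eventually_conj)
  qed
  obtain Q where Q: "\<forall>\<^sub>F x in nhds (0::'a). Q x" "\<And>u v. Q u \<Longrightarrow> Q v \<Longrightarrow> P (u + v)"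
    using half[OF assms] by blast
  obtain R where R: "\<forall>\<^sub>F x in nhds (0::'a). R x" "\<And>u v. R u \<Longrightarrow> R v \<Longrightarrow> Q (u + v)"
    using half[OF Q(1)] by blast
  show ?thesis
    by (rule that[of "\<lambda>x. Q x \<and> R x"]) (use Q R in \<open>auto intro: eventually_conj\<close>)
qed

text \<open>
  The substitute for Urysohn's lemma. With \<open>N\<close> the gauge described above, the distance
  \<open>d x = (INF s\<in>S. N (x - s))\<close> satisfies \<open>d (u + y) \<le> N u + d y\<close>, where \<open>N\<close> is small near the neutral
  element, so it is right uniformly continuous, and
  \<open>d x < 1/2\<close> forces \<open>x \<in> V + S\<close>; the bump is \<open>max 0 (1 - 2 d)\<close>.
\<close>

lemma bump_function:
  fixes V S :: "'a::topological_group_add set"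
  assumes V: "identity_neighbourhood V"
  obtains b where "b \<in> right_UCb" "\<And>x. 0 \<le> b x" "\<And>x. b x \<le> 1" "\<And>x. x \<in> S \<Longrightarrow> b x = 1"
    "\<And>x. b x \<noteq> 0 \<Longrightarrow> \<exists>v\<in>V. \<exists>s\<in>S. x = v + s"
proof (cases "S = {}")
  case True
  show ?thesis by (rule that[of "\<lambda>_. 0"]) (auto simp: True right_UCb_const)
next
  case False
  define nbhd where "nbhd W \<longleftrightarrow> (\<forall>\<^sub>F x in nhds (0::'a). x \<in> W)" for W
  have "\<exists>W. nbhd W \<and> (\<forall>u\<in>W. \<forall>v\<in>W. \<forall>w\<in>W. u + v + w \<in> W')" if "nbhd W'" for W'
  proof -
    from that obtain Q where "\<forall>\<^sub>F x in nhds (0::'a). Q x"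
        "\<And>u v w. Q u \<Longrightarrow> Q v \<Longrightarrow> Q w \<Longrightarrow> u + v + w \<in> W'"
      unfolding nbhd_def using neighbourhood_triple_sum[of "\<lambda>x. x \<in> W'"] by blast
    then show ?thesis by (intro exI[of _ "Collect Q"]) (auto simp: nbhd_def)
  qed
  then obtain refine where nxt: "\<And>W. nbhd W \<Longrightarrow> nbhd (refine W)"
    "\<And>W u v w. nbhd W \<Longrightarrow> u \<in> refine W \<Longrightarrow> v \<in> refine W \<Longrightarrow> w \<in> refine W \<Longrightarrow> u + v + w \<in> W"
    by metis
  \<comment> \<open>The whole group as member of index 0 makes the gauge finite (at most 1) everywhere; the given
    neighbourhood has index 1 and hence corresponds to gauge values below \<open>1/2\<close>.\<close>
  define A where "A n = (case n of 0 \<Rightarrow> UNIV | Suc k \<Rightarrow> (refine ^^ k) V)" for n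
  have nbhd: "nbhd ((refine ^^ k) V)" for k
    using V by (induction k) (auto simp: nxt(1), simp add: nbhd_def identity_neighbourhood_iff_eventually)
  then have nbhdA: "nbhd (A n)" for n
    by (cases n) (auto simp: A_def nbhd_def)
  then have zeroA: "0 \<in> A n" for n
    unfolding nbhd_def by (metis eventually_nhds_x_imp_x)
  have triA: "u + v + w \<in> A n" if "u \<in> A (Suc n)" "v \<in> A (Suc n)" "w \<in> A (Suc n)" for n u v w
    using that nxt(2)[OF nbhd] by (cases n) (auto simp: A_def)
  define N where "N x = Inf {weight ns | ns. x \<in> chain_sum A ns}" for x
  have bdd: "bdd_below {weight ns | ns. x \<in> chain_sum A ns}" for x
    by (intro bdd_belowI[of _ 0]) (use weight_nonneg in auto)
  have singleton: "x \<in> chain_sum A [n]" if "x \<in> A n" for x n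
    using that by force
  have nonempty: "{weight ns | ns. x \<in> chain_sum A ns} \<noteq> {}" for x
  proof -
    have "x \<in> chain_sum A [0]" by (rule singleton) (simp add: A_def)
    then show ?thesis by blast
  qed
  have N_le: "N x \<le> weight ns" if "x \<in> chain_sum A ns" for x ns
    unfolding N_def using that bdd by (intro cInf_lower) auto
  have N_nonneg: "0 \<le> N x" for x
    unfolding N_def using nonempty weight_nonneg by (intro cInf_greatest) auto
  have N_less: "\<exists>ns. x \<in> chain_sum A ns \<and> weight ns < t" if "N x < t" for x t
    using cInf_lessD[OF nonempty that[unfolded N_def]] by auto
  have N_add: "N (x + y) \<le> N x + N y" for x y
  proof (rule field_le_epsilon)
    fix e :: real assume "e > 0"
    then obtain ms ns where "x \<in> chain_sum A ms" "weight ms < N x + e/2"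
        "y \<in> chain_sum A ns" "weight ns < N y + e/2"
      using N_less[of x "N x + e/2"] N_less[of y "N y + e/2"] by auto
    moreover from this have "N (x + y) \<le> weight (ms @ ns)"
      by (intro N_le) (auto simp: chain_sum_append)
    ultimately show "N (x + y) \<le> N x + N y + e" by simp
  qed
  have N_0: "N 0 = 0"
    using N_le[of 0 "[]"] N_nonneg[of 0] by simp
  have N_A: "N x \<le> (1/2) ^ n" if "x \<in> A n" for x n
    using N_le[OF singleton[OF that]] by simp
  have N_V: "x \<in> V" if less_half: "N x < 1/2" for x
  proof -
    obtain ns where "x \<in> chain_sum A ns" "weight ns < (1/2) ^ 1"
      using N_less[OF less_half] by (auto simp only: power_one_right)
    with chain_sum_subset[where V = A and ns = ns and m = 1, OF zeroA triA]
    have "x \<in> A 1" by blast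
    then show ?thesis by (simp add: A_def)
  qed
  define d where "d x = (INF s\<in>S. N (x - s))" for x
  have bddd: "bdd_below ((\<lambda>s. N (x - s)) ` S)" for x
    using N_nonneg by (intro bdd_belowI[of _ 0]) auto
  have d_nonneg: "0 \<le> d x" for x
    unfolding d_def using False N_nonneg by (intro cINF_greatest) auto
  have d_le: "d x \<le> N (x - s)" if "s \<in> S" for x s
    unfolding d_def using that bddd by (intro cINF_lower) auto
  have d_add: "d (u + y) \<le> N u + d y" for u y
  proof -
    have "d (u + y) - N u \<le> N (y - s)" if "s \<in> S" for s
    proof -
      have "u + y - s = u + (y - s)" by (simp add: diff_conv_add_uminus add.assoc del: add_uminus_conv_diff)
      then show ?thesis using d_le[OF that, of "u + y"] N_add[of u "y - s"] by simp
    qed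
    then have "d (u + y) - N u \<le> d y" unfolding d_def[of y] using False by (intro cINF_greatest)
    then show ?thesis by simp
  qed
  have d_S: "d x = 0" if "x \<in> S" for x
    using d_le[OF that, of x] d_nonneg[of x] N_0 by simp
  have d1: "d x \<le> 1" for x
  proof -
    obtain s where "s \<in> S" using False by blast
    then show ?thesis using d_le[of s x] N_A[of "x - s" 0] by (simp add: A_def)
  qed
  have dUC: "d \<in> right_UCb"
    unfolding right_UCb_iff
  proof (intro conjI allI impI)
    fix \<epsilon> :: real assume "\<epsilon> > 0"
    then obtain n where n: "(1/2) ^ n < \<epsilon>"
      using real_arch_pow_inv[of \<epsilon> "1/2"] by auto
    have An: "\<forall>\<^sub>F u in nhds 0. u \<in> A n" using nbhdA by (simp add: nbhd_def)
    moreover have "filterlim uminus (nhds 0) (nhds (0::'a))"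
      using tendsto_uminus_nhds[of "0::'a"] by simp
    from eventually_compose_filterlim[OF An this] have "\<forall>\<^sub>F u in nhds 0. - u \<in> A n" .
    ultimately show "\<forall>\<^sub>F u in nhds 0. \<forall>y. \<bar>d (u + y) - d y\<bar> \<le> \<epsilon>"
    proof eventually_elim
      case (elim u)
      then have "N u \<le> \<epsilon>" "N (- u) \<le> \<epsilon>" using N_A n by force+
      moreover have "d y \<le> N (- u) + d (u + y)" for y
        using d_add[of "- u" "u + y"] by (simp add: add.assoc[symmetric])
      ultimately show ?case using d_add[of u] by (smt (verit, best))
    qed
  next
    show "\<exists>B. \<forall>x. \<bar>d x\<bar> \<le> B" using d_nonneg d1 by (intro exI[of _ 1]) auto
  qed
  show ?thesis
  proof (rule that[of "\<lambda>x. max 0 (1 - 2 * d x)"])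
    show "(\<lambda>x. max 0 (1 - 2 * d x)) \<in> right_UCb"
      by (intro right_UCb_max right_UCb_diff right_UCb_scale right_UCb_const dUC)
    fix x assume "max 0 (1 - 2 * d x) \<noteq> 0"
    then have "d x < 1/2" by linarith
    then obtain s where "s \<in> S" "N (x - s) < 1/2"
      using cInf_lessD[of "(\<lambda>s. N (x - s)) ` S" "1/2"] False unfolding d_def by auto
    then show "\<exists>v\<in>V. \<exists>s\<in>S. x = v + s" using N_V by (metis diff_add_cancel)
  qed (use d_nonneg d_S in auto)
qed

section \<open>Means\<close>

lemma mean_add:
  "right_mean \<nu> \<Longrightarrow> f \<in> right_UCb \<Longrightarrow> g \<in> right_UCb \<Longrightarrow> \<nu> (\<lambda>x. f x + g x) = \<nu> f + \<nu> g"
  by (simp add: right_mean_def)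

lemma mean_scale: "right_mean \<nu> \<Longrightarrow> f \<in> right_UCb \<Longrightarrow> \<nu> (\<lambda>x. c * f x) = c * \<nu> f"
  by (simp add: right_mean_def)

lemma mean_diff:
  assumes "right_mean \<nu>" "f \<in> right_UCb" "g \<in> right_UCb"
  shows "\<nu> (\<lambda>x. f x - g x) = \<nu> f - \<nu> g"
  using mean_add[OF assms(1,2) right_UCb_scale[OF assms(3), of "-1"]]
    mean_scale[OF assms(1,3), of "-1"] by simp

lemma mean_lower:
  assumes "right_mean \<nu>" "f \<in> right_UCb" "\<And>x. a \<le> f x" shows "a \<le> \<nu> f"
proof -
  have "a \<le> (INF x. f x)" using assms(3) by (intro cINF_greatest) auto
  also have "\<dots> \<le> \<nu> f" using assms by (simp add: right_mean_def)
  finally show ?thesis .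
qed

lemma mean_upper:
  assumes "right_mean \<nu>" "f \<in> right_UCb" "\<And>x. f x \<le> a" shows "\<nu> f \<le> a"
proof -
  have "\<nu> f \<le> (SUP x. f x)" using assms by (simp add: right_mean_def)
  also have "\<dots> \<le> a" using assms(3) by (intro cSUP_least) auto
  finally show ?thesis .
qed

lemma mean_const: "right_mean \<nu> \<Longrightarrow> \<nu> (\<lambda>_. c) = c"
  using mean_upper[of \<nu> "\<lambda>_. c" c] mean_lower[of \<nu> "\<lambda>_. c" c] right_UCb_const[of c] by force

lemma mean_abs_le:
  assumes "right_mean \<nu>" "f \<in> right_UCb" "\<And>x. \<bar>f x\<bar> \<le> B" shows "\<bar>\<nu> f\<bar> \<le> B"
proof -
  have "- B \<le> f x" "f x \<le> B" for x using assms(3)[of x] by auto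
  then show ?thesis
    using mean_lower[OF assms(1,2), of "- B"] mean_upper[OF assms(1,2), of B] by auto
qed

lemma right_UCb_INF_le:
  assumes "f \<in> right_UCb" shows "(INF x. f x) \<le> f y"
proof -
  obtain B where "\<And>x. \<bar>f x\<bar> \<le> B" using right_UCb_bound[OF assms] by metis
  then have "- B \<le> f x" for x by (metis abs_le_D2 minus_le_iff)
  then have "bdd_below (range f)" by (intro bdd_belowI[of _ "- B"]) auto
  then show ?thesis by (auto intro: cINF_lower)
qed

lemma right_UCb_le_SUP:
  assumes "f \<in> right_UCb" shows "f y \<le> (SUP x. f x)"
proof -
  obtain B where "\<And>x. \<bar>f x\<bar> \<le> B" using right_UCb_bound[OF assms] by metis
  then have "bdd_above (range f)" by (intro bdd_aboveI[of _ B]) (auto simp: abs_le_iff)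
  then show ?thesis by (auto intro: cSUP_upper)
qed

lemma mean_sum:
  assumes "right_mean \<nu>" "\<And>i. i \<in> I \<Longrightarrow> f i \<in> right_UCb"
  shows "\<nu> (\<lambda>x. \<Sum>i\<in>I. f i x) = (\<Sum>i\<in>I. \<nu> (f i))"
  using assms(2)
  by (induction I rule: infinite_finite_induct)
     (auto simp: mean_const[OF assms(1)] mean_add[OF assms(1)] right_UCb_sum)

lemma mean_less_imp_point:
  "right_mean \<nu> \<Longrightarrow> f \<in> right_UCb \<Longrightarrow> \<nu> f < t \<Longrightarrow> \<exists>x. f x < t"
  using mean_lower[of \<nu> f t] by (meson not_le)

text \<open>
  A mean is constrained only on \<^const>\<open>right_UCb\<close>. Fixing the value 0 elsewhere makes the set of means a
  closed subset of a product of compact intervals.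
\<close>

definition normalised_means :: "(('a::topological_group_add \<Rightarrow> real) \<Rightarrow> real) set" where
  "normalised_means = {\<nu>. right_mean \<nu> \<and> (\<forall>f. f \<notin> right_UCb \<longrightarrow> \<nu> f = 0)}"

text \<open>
  Tychonoff's theorem: the bounds between infimum and supremum cut out a product of compact
  intervals, and additivity and homogeneity are closed conditions for the product topology.
\<close>

lemma compact_normalised_means:
  "compact (normalised_means :: (('a::topological_group_add \<Rightarrow> real) \<Rightarrow> real) set)"
proof -
  define K :: "('a \<Rightarrow> real) \<Rightarrow> real set"
    where "K f = (if f \<in> right_UCb then {INF x. f x .. SUP x. f x} else {0})" for f
  have "compactin (product_topology (\<lambda>_. euclidean) UNIV) (PiE UNIV K)"
    by (auto simp: compactin_PiE K_def)
  then have "compact (PiE UNIV K)"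
    by (simp add: euclidean_product_topology)
  have cont: "continuous_on UNIV (\<lambda>\<nu>. \<nu> f)" for f :: "'a \<Rightarrow> real"
    by (rule continuous_on_product_coordinates)
  define A :: "(('a \<Rightarrow> real) \<Rightarrow> real) set" where "A =
    (\<Inter>f\<in>right_UCb. \<Inter>g\<in>right_UCb. {\<nu>. \<nu> (\<lambda>x. f x + g x) = \<nu> f + \<nu> g})"
  define S :: "(('a \<Rightarrow> real) \<Rightarrow> real) set" where "S =
    (\<Inter>c. \<Inter>f\<in>right_UCb. {\<nu>. \<nu> (\<lambda>x. c * f x) = c * \<nu> f})"
  have A: "closed A"
    unfolding A_def 
    by (intro closed_INT ballI) (rule closed_Collect_eq[OF cont continuous_on_add[OF cont cont]])
  have S: "closed S"
    unfolding S_def 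
    by (intro closed_INT ballI)
       (rule closed_Collect_eq[OF cont continuous_on_mult[OF continuous_on_const cont]])
  have K: "(\<nu> \<in> PiE UNIV K) \<longleftrightarrow> (\<forall>f\<in>right_UCb. (INF x. f x) \<le> \<nu> f \<and> \<nu> f \<le> (SUP x. f x)) \<and>
      (\<forall>f. f \<notin> right_UCb \<longrightarrow> \<nu> f = 0)" for \<nu>
  proof -
    have "\<nu> f \<in> K f \<longleftrightarrow> (f \<in> right_UCb \<longrightarrow> (INF x. f x) \<le> \<nu> f \<and> \<nu> f \<le> (SUP x. f x)) \<and>
        (f \<notin> right_UCb \<longrightarrow> \<nu> f = 0)" for f
      by (simp add: K_def)
    then have "(\<forall>f. \<nu> f \<in> K f) \<longleftrightarrow> (\<forall>f\<in>right_UCb. (INF x. f x) \<le> \<nu> f \<and> \<nu> f \<le> (SUP x. f x)) \<and>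
        (\<forall>f. f \<notin> right_UCb \<longrightarrow> \<nu> f = 0)"
      by (simp only: Ball_def) iprover
    then show ?thesis by (simp add: PiE_UNIV_domain Pi_iff)
  qed
  have "normalised_means = PiE UNIV K \<inter> (A \<inter> S)"
    unfolding normalised_means_def right_mean_def set_eq_iff Int_iff K mem_Collect_eq A_def S_def
      INT_iff ball_UNIV
    by iprover
  then show ?thesis
    using compact_Int_closed[OF \<open>compact (PiE UNIV K)\<close> closed_Int[OF A S]] by simp
qed

text \<open>
  The form in which compactness of the set of means is used: an approximation property holding for
  every finite set of test functions passes to all of them simultaneously.
\<close>

lemma mean_satisfying_all_inequalities:
  fixes u v :: "'i \<Rightarrow> 'a::topological_group_add \<Rightarrow> real"
  assumes "\<And>J. finite J \<Longrightarrow> J \<subseteq> I \<Longrightarrow> \<exists>\<nu>\<in>normalised_means. \<forall>i\<in>J. \<nu> (u i) - \<nu> (v i) \<le> c i"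
  shows "\<exists>\<nu>\<in>normalised_means. \<forall>i\<in>I. \<nu> (u i) - \<nu> (v i) \<le> c i"
proof -
  have cont: "continuous_on UNIV (\<lambda>\<nu>. \<nu> f)" for f :: "'a \<Rightarrow> real"
    by (rule continuous_on_product_coordinates)
  have "closed {\<nu>. \<nu> (u i) - \<nu> (v i) \<le> c i}" for i
    by (rule closed_Collect_le[OF continuous_on_diff[OF cont cont] continuous_on_const])
  moreover have "normalised_means \<inter> (\<Inter>i\<in>J. {\<nu>. \<nu> (u i) - \<nu> (v i) \<le> c i}) \<noteq> {}"
    if "finite J" "J \<subseteq> I" for J
    using assms[OF that] unfolding Bex_def disjoint_iff by simp
  ultimately have "normalised_means \<inter> (\<Inter>i\<in>I. {\<nu>. \<nu> (u i) - \<nu> (v i) \<le> c i}) \<noteq> {}"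
    by (rule compact_imp_fip_image[OF compact_normalised_means])
  then show ?thesis by blast
qed

definition average_on :: "'a set \<Rightarrow> ('a::topological_group_add \<Rightarrow> real) \<Rightarrow> real" where
  "average_on F f = (if f \<in> right_UCb then (\<Sum>x\<in>F. f x) / card F else 0)"

lemma average_on_normalised:
  fixes F :: "'a::topological_group_add set"
  assumes F: "finite F" "F \<noteq> {}"
  shows "average_on F \<in> normalised_means"
proof -
  have n: "real (card F) > 0" using F by (simp add: card_gt_0_iff)
  have "(INF x. f x) \<le> average_on F f \<and> average_on F f \<le> (SUP x. f x)" if f: "f \<in> right_UCb" for f :: "'a \<Rightarrow> real"
  proof -
    have "card F * (INF x. f x) \<le> (\<Sum>x\<in>F. f x)" "(\<Sum>x\<in>F. f x) \<le> card F * (SUP x. f x)"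
      using right_UCb_INF_le[OF f] right_UCb_le_SUP[OF f] by (auto intro: sum_bounded_below sum_bounded_above)
    then show ?thesis using n f by (simp add: average_on_def field_simps)
  qed
  then show ?thesis
    by (auto simp: normalised_means_def right_mean_def average_on_def right_UCb_add right_UCb_scale
        sum.distrib add_divide_distrib simp flip: sum_distrib_left)
qed

section \<open>Convolution of means\<close>

text \<open>
  The function \<open>g \<mapsto> \<nu> (f \<circ> \<lambda>(g))\<close>. It is constant exactly when \<open>\<nu>\<close> gives all left translates of \<open>f\<close>
  the same value, so its oscillation measures the failure of invariance at \<open>f\<close>.
\<close>

definition translation_profile :: "(('a::topological_group_add \<Rightarrow> real) \<Rightarrow> real) \<Rightarrow> ('a \<Rightarrow> real) \<Rightarrow> 'a \<Rightarrow> real" where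
  "translation_profile \<nu> f g = \<nu> (\<lambda>x. f (g + x))"

text \<open>
  For the right uniformity, \<open>(u + y + x) - (y + x) = u\<close> for every \<open>x\<close>. So moving the parameter by a small \<open>u\<close>
  moves all values of \<open>f\<close> simultaneously by little, and a mean does not enlarge the difference.
\<close>

lemma translation_profile_UCb:
  fixes f :: "'a::topological_group_add \<Rightarrow> real"
  assumes \<nu>: "right_mean \<nu>" and f: "f \<in> right_UCb"
  shows "translation_profile \<nu> f \<in> right_UCb"
  unfolding right_UCb_iff
proof (intro conjI allI impI)
  fix \<epsilon> :: real assume "\<epsilon> > 0"
  from right_UCb_oscillation[OF f this]
  show "\<forall>\<^sub>F u in nhds 0. \<forall>y. \<bar>translation_profile \<nu> f (u + y) - translation_profile \<nu> f y\<bar> \<le> \<epsilon>"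
  proof eventually_elim
    case (elim u)
    show ?case
    proof
      fix y
      have eq: "translation_profile \<nu> f (u + y) - translation_profile \<nu> f y
          = \<nu> (\<lambda>x. f (u + y + x) - f (y + x))"
        unfolding translation_profile_def
        by (rule mean_diff[symmetric]) (intro \<nu> right_UCb_left_translate f)+
      have UC: "(\<lambda>x. f (u + y + x) - f (y + x)) \<in> right_UCb"
        by (intro right_UCb_diff right_UCb_left_translate f)
      have "\<bar>f (u + y + x) - f (y + x)\<bar> \<le> \<epsilon>" for x
        using elim by (simp add: add.assoc)
      from mean_abs_le[OF \<nu> UC this] show "\<bar>translation_profile \<nu> f (u + y) - translation_profile \<nu> f y\<bar> \<le> \<epsilon>"
        unfolding eq .
    qed
  qed
next
  obtain B where B: "\<And>x. \<bar>f x\<bar> \<le> B" using right_UCb_bound[OF f] by metis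
  have "\<bar>translation_profile \<nu> f g\<bar> \<le> B" for g
    unfolding translation_profile_def
    by (rule mean_abs_le[OF \<nu> right_UCb_left_translate[OF f]]) (rule B)
  then show "\<exists>B. \<forall>x. \<bar>translation_profile \<nu> f x\<bar> \<le> B" by blast
qed

definition convolution :: "(('a::topological_group_add \<Rightarrow> real) \<Rightarrow> real) \<Rightarrow> (('a \<Rightarrow> real) \<Rightarrow> real)
    \<Rightarrow> ('a \<Rightarrow> real) \<Rightarrow> real" where
  "convolution \<nu> \<nu>' f = (if f \<in> right_UCb then \<nu>' (translation_profile \<nu> f) else 0)"

lemma convolution_normalised:
  fixes \<nu> \<nu>' :: "('a::topological_group_add \<Rightarrow> real) \<Rightarrow> real"
  assumes \<nu>: "right_mean \<nu>" and \<nu>': "right_mean \<nu>'"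
  shows "convolution \<nu> \<nu>' \<in> normalised_means"
proof -
  have add: "convolution \<nu> \<nu>' (\<lambda>x. f x + g x) = convolution \<nu> \<nu>' f + convolution \<nu> \<nu>' g"
    if f: "f \<in> right_UCb" and g: "g \<in> right_UCb" for f g :: "'a \<Rightarrow> real"
  proof -
    have "translation_profile \<nu> (\<lambda>x. f x + g x)
        = (\<lambda>h. translation_profile \<nu> f h + translation_profile \<nu> g h)"
      unfolding translation_profile_def
      by (rule ext) (rule mean_add[OF \<nu> right_UCb_left_translate[OF f] right_UCb_left_translate[OF g]])
    then show ?thesis
      using f g by (simp add: convolution_def right_UCb_add mean_add[OF \<nu>'] translation_profile_UCb[OF \<nu>])
  qed
  have scale: "convolution \<nu> \<nu>' (\<lambda>x. c * f x) = c * convolution \<nu> \<nu>' f"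
    if f: "f \<in> right_UCb" for f :: "'a \<Rightarrow> real" and c
  proof -
    have "translation_profile \<nu> (\<lambda>x. c * f x) = (\<lambda>h. c * translation_profile \<nu> f h)"
      unfolding translation_profile_def
      by (rule ext) (rule mean_scale[OF \<nu> right_UCb_left_translate[OF f]])
    then show ?thesis
      using f by (simp add: convolution_def right_UCb_scale mean_scale[OF \<nu>'] translation_profile_UCb[OF \<nu>])
  qed
  have "(INF x. f x) \<le> convolution \<nu> \<nu>' f \<and> convolution \<nu> \<nu>' f \<le> (SUP x. f x)"
    if f: "f \<in> right_UCb" for f :: "'a \<Rightarrow> real"
  proof -
    have "(INF x. f x) \<le> translation_profile \<nu> f h" "translation_profile \<nu> f h \<le> (SUP x. f x)" for h
      unfolding translation_profile_def
      using mean_lower[OF \<nu> right_UCb_left_translate[OF f] right_UCb_INF_le[OF f]]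
        mean_upper[OF \<nu> right_UCb_left_translate[OF f] right_UCb_le_SUP[OF f]] by auto
    then show ?thesis
      using f mean_lower[OF \<nu>' translation_profile_UCb[OF \<nu> f]]
        mean_upper[OF \<nu>' translation_profile_UCb[OF \<nu> f]] by (simp add: convolution_def)
  qed
  with add scale show ?thesis
    by (auto simp: normalised_means_def right_mean_def) (simp add: convolution_def)
qed

text \<open>
  Convolving means composes their profile operators. Profiles can therefore be improved
  one after the other: what \<open>\<nu>\<close> has made constant, \<open>\<nu>'\<close> keeps constant.
\<close>

lemma translation_profile_convolution:
  assumes "right_mean \<nu>" "f \<in> right_UCb"
  shows "translation_profile (convolution \<nu> \<nu>') f = translation_profile \<nu>' (translation_profile \<nu> f)"
proof
  fix g
  have "translation_profile \<nu> (\<lambda>x. f (g + x)) = (\<lambda>h. translation_profile \<nu> f (g + h))"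
    by (rule ext) (simp add: translation_profile_def add.assoc)
  then show "translation_profile (convolution \<nu> \<nu>') f g = translation_profile \<nu>' (translation_profile \<nu> f) g"
    using right_UCb_left_translate[OF assms(2)]
    by (simp add: translation_profile_def[of _ f] translation_profile_def[of \<nu>'] convolution_def)
qed

section \<open>From contracted averages to an invariant mean\<close>

text \<open>
  The consequence of the matching conditions that is used: for each single function, averaging over a
  suitable finite set shrinks the oscillation along any finite set of translates by the fixed factor \<open>c\<close>.
\<close>

definition contracts_averages :: "real \<Rightarrow> 'a::topological_group_add itself \<Rightarrow> bool" where
  "contracts_averages c _ \<longleftrightarrow> (\<forall>f\<in>(right_UCb :: ('a \<Rightarrow> real) set). (\<forall>x. 0 \<le> f x \<and> f x \<le> 1) \<longrightarrow>
     (\<forall>E. finite E \<longrightarrow> (\<exists>F. finite F \<and> F \<noteq> {} \<and>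
        (\<forall>g\<in>E. \<forall>h\<in>E. (\<Sum>x\<in>F. f (g + x)) - (\<Sum>x\<in>F. f (h + x)) \<le> c * card F))))"

context
  fixes c :: real and G :: "'a::topological_group_add itself"
  assumes c: "0 \<le> c" "c < 1"
    and contracts: "contracts_averages c G"
begin

text \<open>
  By compactness the set \<open>E\<close> of translations may be replaced with the whole group, at the price of
  replacing averages over finite sets with means.
\<close>

lemma oscillation_contracted_01:
  fixes f :: "'a \<Rightarrow> real"
  assumes f: "f \<in> right_UCb" "\<And>x. 0 \<le> f x" "\<And>x. f x \<le> 1"
  shows "\<exists>\<nu>\<in>normalised_means. \<forall>g h. translation_profile \<nu> f g - translation_profile \<nu> f h \<le> c"
proof -
  have "\<exists>\<nu>\<in>normalised_means. \<forall>i\<in>UNIV. \<nu> (\<lambda>x. f (fst i + x)) - \<nu> (\<lambda>x. f (snd i + x)) \<le> c"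
  proof (rule mean_satisfying_all_inequalities)
    fix J :: "('a \<times> 'a) set" assume J: "finite J"
    then have "finite (fst ` J \<union> snd ` J)" by simp
    with contracts f obtain F where F: "finite F" "F \<noteq> {}"
      "\<forall>g\<in>fst ` J \<union> snd ` J. \<forall>h\<in>fst ` J \<union> snd ` J.
         (\<Sum>x\<in>F. f (g + x)) - (\<Sum>x\<in>F. f (h + x)) \<le> c * card F"
      unfolding contracts_averages_def by meson
    then have n: "real (card F) > 0" by (simp add: card_gt_0_iff)
    have "average_on F (\<lambda>x. f (fst i + x)) - average_on F (\<lambda>x. f (snd i + x)) \<le> c" if "i \<in> J" for i
    proof -
      have "(\<Sum>x\<in>F. f (fst i + x)) - (\<Sum>x\<in>F. f (snd i + x)) \<le> c * card F"
        using F(3) that by blast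
      then show ?thesis
        using n f(1) by (simp add: average_on_def right_UCb_left_translate field_simps)
    qed
    with average_on_normalised[OF F(1,2)]
    show "\<exists>\<nu>\<in>normalised_means. \<forall>i\<in>J. \<nu> (\<lambda>x. f (fst i + x)) - \<nu> (\<lambda>x. f (snd i + x)) \<le> c"
      by blast
  qed
  then show ?thesis by (auto simp: translation_profile_def)
qed

lemma oscillation_contracted:
  fixes f :: "'a \<Rightarrow> real"
  assumes f: "f \<in> right_UCb" and L: "\<And>x y. f x - f y \<le> L"
  shows "\<exists>\<nu>\<in>normalised_means. \<forall>g h. translation_profile \<nu> f g - translation_profile \<nu> f h \<le> c * L"
proof (cases "L > 0")
  case False
  have f0: "f x = f 0" for x using L[of x 0] L[of 0 x] False by linarith
  have "translation_profile \<nu> f g = \<nu> (\<lambda>_. f 0)" for \<nu> g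
    unfolding translation_profile_def by (rule arg_cong[where f = \<nu>]) (rule ext, rule f0)
  moreover have "average_on {0} \<in> (normalised_means :: (('a \<Rightarrow> real) \<Rightarrow> real) set)"
    by (rule average_on_normalised) auto
  moreover have "L = 0" using False L[of 0 0] by simp
  ultimately show ?thesis
    by (intro bexI[of _ "average_on {0}"]) auto
next
  case True
  define m where "m = (INF x. f x)"
  have m1: "m \<le> f x" for x unfolding m_def by (rule right_UCb_INF_le[OF f])
  have m2: "f x \<le> m + L" for x
  proof -
    have "f x - L \<le> m" unfolding m_def using L[of x] by (intro cINF_greatest) (auto simp: algebra_simps)
    then show ?thesis by simp
  qed
  define f1 where "f1 = (\<lambda>x. (1/L) * (f x - m))"
  have f1: "f1 \<in> right_UCb"
    unfolding f1_def by (intro right_UCb_scale right_UCb_diff right_UCb_const f)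
  have f1_nonneg: "0 \<le> f1 x" and f1_le: "f1 x \<le> 1" for x
    using m1[of x] m2[of x] True by (auto simp: f1_def field_simps)
  obtain \<nu> where \<nu>: "\<nu> \<in> normalised_means"
    and osc: "\<And>g h. translation_profile \<nu> f1 g - translation_profile \<nu> f1 h \<le> c"
    using oscillation_contracted_01[OF f1 f1_nonneg f1_le] by blast
  have "translation_profile \<nu> f1 g = (1/L) * (translation_profile \<nu> f g - m)" for g
  proof -
    have r: "right_mean \<nu>" using \<nu> by (simp add: normalised_means_def)
    have UC: "(\<lambda>x. f (g + x)) \<in> right_UCb" by (rule right_UCb_left_translate[OF f])
    have "translation_profile \<nu> f1 g = (1/L) * \<nu> (\<lambda>x. f (g + x) - m)"
      unfolding translation_profile_def f1_def
      by (rule mean_scale[OF r right_UCb_diff[OF UC right_UCb_const]])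
    also have "\<nu> (\<lambda>x. f (g + x) - m) = \<nu> (\<lambda>x. f (g + x)) - m"
      by (simp add: mean_diff[OF r UC right_UCb_const] mean_const[OF r])
    finally show ?thesis by (simp add: translation_profile_def)
  qed
  then have "(translation_profile \<nu> f g - translation_profile \<nu> f h) / L \<le> c" for g h
    using osc[of g h] by (simp add: diff_divide_distrib)
  then have "translation_profile \<nu> f g - translation_profile \<nu> f h \<le> c * L" for g h
    using True by (simp add: pos_divide_le_eq)
  with \<nu> show ?thesis by blast
qed

text \<open>
  The profile is again a right uniformly continuous function on the group, now with oscillation
  \<open>c ^ (k + 1) * L\<close>, so contraction applies to it as well; convolution collects the means used.
\<close>

lemma oscillation_power:
  fixes f :: "'a \<Rightarrow> real"
  assumes f: "f \<in> right_UCb" and L: "\<And>x y. f x - f y \<le> L"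
  shows "\<exists>\<nu>\<in>normalised_means. \<forall>g h. translation_profile \<nu> f g - translation_profile \<nu> f h \<le> c ^ Suc k * L"
proof (induction k)
  case 0
  then show ?case using oscillation_contracted[OF f L] by simp
next
  case (Suc k)
  then obtain \<nu> where \<nu>: "right_mean \<nu>"
    and osc: "\<And>g h. translation_profile \<nu> f g - translation_profile \<nu> f h \<le> c ^ Suc k * L"
    by (auto simp: normalised_means_def)
  obtain \<nu>' where \<nu>': "right_mean \<nu>'" "\<And>g h. translation_profile \<nu>' (translation_profile \<nu> f) g
      - translation_profile \<nu>' (translation_profile \<nu> f) h \<le> c * (c ^ Suc k * L)"
    using oscillation_contracted[OF translation_profile_UCb[OF \<nu> f] osc] by (auto simp: normalised_means_def)
  show ?case
    by (rule bexI[OF _ convolution_normalised[OF \<nu> \<nu>'(1)]])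
       (use \<nu>'(2) in \<open>auto simp: translation_profile_convolution[OF \<nu> f] algebra_simps\<close>)
qed

text \<open>
  The bounds \<open>c ^ (k + 1) * (2 * B)\<close> tend to 0, and compactness provides one mean that satisfies all of them.
\<close>

lemma constant_profile:
  fixes f :: "'a \<Rightarrow> real"
  assumes f: "f \<in> right_UCb"
  shows "\<exists>\<nu>\<in>normalised_means. \<forall>g h. translation_profile \<nu> f g = translation_profile \<nu> f h"
proof -
  obtain B where B: "\<And>x. \<bar>f x\<bar> \<le> B" using right_UCb_bound[OF f] by metis
  have L: "f x - f y \<le> 2 * B" for x y using B[of x] B[of y] by linarith
  have L0: "0 \<le> 2 * B" using L[of 0 0] by simp
  have "\<exists>\<nu>\<in>normalised_means. \<forall>i\<in>UNIV. \<nu> (\<lambda>x. f (fst (fst i) + x)) - \<nu> (\<lambda>x. f (snd (fst i) + x))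
      \<le> c ^ Suc (snd i) * (2 * B)"
  proof (rule mean_satisfying_all_inequalities)
    fix J :: "(('a \<times> 'a) \<times> nat) set" assume J: "finite J"
    obtain k where k: "\<And>i. i \<in> J \<Longrightarrow> snd i \<le> k"
      using finite_nat_set_iff_bounded_le[of "snd ` J"] J by auto
    obtain \<nu> where \<nu>: "\<nu> \<in> normalised_means"
      "\<And>g h. translation_profile \<nu> f g - translation_profile \<nu> f h \<le> c ^ Suc k * (2 * B)"
      using oscillation_power[OF f L] by blast
    have "\<nu> (\<lambda>x. f (fst (fst i) + x)) - \<nu> (\<lambda>x. f (snd (fst i) + x)) \<le> c ^ Suc (snd i) * (2 * B)"
      if "i \<in> J" for i
    proof -
      have "c ^ Suc k * (2 * B) \<le> c ^ Suc (snd i) * (2 * B)"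
        using k[OF that] c L0 by (intro mult_right_mono power_decreasing) auto
      then show ?thesis
        using \<nu>(2)[of "fst (fst i)" "snd (fst i)"] unfolding translation_profile_def by linarith
    qed
    with \<nu>(1) show "\<exists>\<nu>\<in>normalised_means. \<forall>i\<in>J. \<nu> (\<lambda>x. f (fst (fst i) + x)) -
        \<nu> (\<lambda>x. f (snd (fst i) + x)) \<le> c ^ Suc (snd i) * (2 * B)" by blast
  qed
  then obtain \<nu> where \<nu>: "\<nu> \<in> normalised_means"
    and osc: "\<And>g h k. translation_profile \<nu> f g - translation_profile \<nu> f h \<le> c ^ Suc k * (2 * B)"
    by (auto simp: translation_profile_def)
  have "(\<lambda>k. c ^ Suc k * (2 * B)) \<longlonglongrightarrow> 0 * (2 * B)"
    using c by (intro tendsto_mult tendsto_const LIMSEQ_Suc LIMSEQ_power_zero) auto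
  then have "translation_profile \<nu> f g - translation_profile \<nu> f h \<le> 0" for g h
    using osc[of g h] by (intro LIMSEQ_le_const[of _ 0]) auto
  then have "translation_profile \<nu> f g = translation_profile \<nu> f h" for g h
    by (metis antisym diff_le_0_iff_le)
  with \<nu> show ?thesis by blast
qed

text \<open>
  This passes from one function to several. Once \<open>\<nu>\<close> works for \<open>\<Phi>\<close>, choose \<open>\<nu>'\<close> for the profile of the new function
  under \<open>\<nu>\<close>; the convolution works for the new function by the choice of \<open>\<nu>'\<close>, and for \<open>\<Phi>\<close> because the
  profile of a constant function is constant.
\<close>

lemma constant_profiles:
  fixes \<Phi> :: "('a \<Rightarrow> real) set"
  assumes "finite \<Phi>" "\<Phi> \<subseteq> right_UCb"
  shows "\<exists>\<nu>\<in>normalised_means. \<forall>f\<in>\<Phi>. \<forall>g h. translation_profile \<nu> f g = translation_profile \<nu> f h"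
  using assms
proof (induction \<Phi> rule: finite_induct)
  case empty
  have "average_on {0} \<in> (normalised_means :: (('a \<Rightarrow> real) \<Rightarrow> real) set)"
    by (rule average_on_normalised) auto
  then show ?case by blast
next
  case (insert f \<Phi>)
  then obtain \<nu> where \<nu>: "right_mean \<nu>"
    and const: "\<And>\<phi> g h. \<phi> \<in> \<Phi> \<Longrightarrow> translation_profile \<nu> \<phi> g = translation_profile \<nu> \<phi> h"
    unfolding normalised_means_def by auto
  have f: "f \<in> right_UCb" using insert.prems by simp
  obtain \<nu>' where \<nu>': "right_mean \<nu>'" "\<And>g h. translation_profile \<nu>' (translation_profile \<nu> f) g
      = translation_profile \<nu>' (translation_profile \<nu> f) h"
    using constant_profile[OF translation_profile_UCb[OF \<nu> f]] by (auto simp: normalised_means_def)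
  have "translation_profile (convolution \<nu> \<nu>') \<phi> g = translation_profile (convolution \<nu> \<nu>') \<phi> h"
    if "\<phi> \<in> insert f \<Phi>" for \<phi> g h
  proof (cases "\<phi> = f")
    case True
    then show ?thesis using \<nu>'(2)[of g h] by (simp add: translation_profile_convolution[OF \<nu> f])
  next
    case False
    then have \<phi>: "\<phi> \<in> \<Phi>" "\<phi> \<in> right_UCb" using that insert.prems by auto
    have "translation_profile \<nu> \<phi> (g + x) = translation_profile \<nu> \<phi> (h + x)" for x
      by (rule const[OF \<phi>(1)])
    then show ?thesis
      unfolding translation_profile_convolution[OF \<nu> \<phi>(2)] by (simp add: translation_profile_def[of \<nu>'])
  qed
  then show ?case using convolution_normalised[OF \<nu> \<nu>'(1)] by blast
qed

lemma amenable_if_contracts_averages: "amenable G"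
proof -
  define I where "I = (right_UCb :: ('a \<Rightarrow> real) set) \<times> (UNIV :: ('a \<times> 'a) set)"
  have "\<exists>\<nu>\<in>normalised_means. \<forall>i\<in>I. \<nu> (\<lambda>x. fst i (fst (snd i) + x)) - \<nu> (\<lambda>x. fst i (snd (snd i) + x)) \<le> 0"
  proof (rule mean_satisfying_all_inequalities)
    fix J assume "finite J" "J \<subseteq> I"
    then have "finite (fst ` J)" "fst ` J \<subseteq> right_UCb" by (auto simp: I_def)
    from constant_profiles[OF this] obtain \<nu> where "\<nu> \<in> normalised_means"
      "\<And>i g h. i \<in> J \<Longrightarrow> translation_profile \<nu> (fst i) g = translation_profile \<nu> (fst i) h"
      by blast
    then show "\<exists>\<nu>\<in>normalised_means. \<forall>i\<in>J. \<nu> (\<lambda>x. fst i (fst (snd i) + x)) - \<nu> (\<lambda>x. fst i (snd (snd i) + x)) \<le> 0"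
      unfolding translation_profile_def by (intro bexI[of _ \<nu>]) (simp_all add: eq_iff)
  qed
  then obtain \<nu> :: "('a \<Rightarrow> real) \<Rightarrow> real" where \<nu>: "\<nu> \<in> normalised_means"
    and le_I: "\<forall>i\<in>I. \<nu> (\<lambda>x. fst i (fst (snd i) + x)) - \<nu> (\<lambda>x. fst i (snd (snd i) + x)) \<le> 0"
    by blast
  have le: "\<nu> (\<lambda>x. f (g + x)) \<le> \<nu> (\<lambda>x. f (h + x))" if "f \<in> right_UCb" for f g h
    using bspec[OF le_I, of "(f, g, h)"] that by (simp add: I_def)
  have "\<nu> (f \<circ> (\<lambda>x. g + x)) = \<nu> f" if "f \<in> right_UCb" for f g
    using le[OF that, of g 0] le[OF that, of 0 g] by (simp add: comp_def)
  with \<nu> show ?thesis by (auto simp: amenable_def normalised_means_def)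
qed

end

section \<open>Matchings and averages\<close>

lemma finite_matching_cards:
  "finite E \<Longrightarrow> finite {card D | D. D \<subseteq> E \<and> P D}"
  by (rule finite_subset[of _ "card ` Pow E"]) auto

lemma matching_number_attained:
  assumes "finite E"
  shows "\<exists>D \<phi>. D \<subseteq> E \<and> inj_on \<phi> D \<and> \<phi> ` D \<subseteq> F \<and> (\<forall>x\<in>D. \<exists>U\<in>\<U>. {x, \<phi> x} \<subseteq> U) \<and>
    card D = matching_number E F \<U>"
proof -
  define P where "P D \<longleftrightarrow> (\<exists>\<phi>. inj_on \<phi> D \<and> \<phi> ` D \<subseteq> F \<and> (\<forall>x\<in>D. \<exists>U\<in>\<U>. {x, \<phi> x} \<subseteq> U))"
    for D
  have "P {}" by (simp add: P_def)
  then have "{card D | D. D \<subseteq> E \<and> P D} \<noteq> {}" by blast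
  from Max_in[OF finite_matching_cards[OF assms] this]
  have "matching_number E F \<U> \<in> {card D | D. D \<subseteq> E \<and> P D}"
    by (simp only: matching_number_def P_def)
  then obtain D where "matching_number E F \<U> = card D" "D \<subseteq> E" "P D" by blast
  then show ?thesis unfolding P_def by metis
qed

lemma matching_number_ge:
  assumes "finite E" "D \<subseteq> E" "inj_on \<phi> D" "\<phi> ` D \<subseteq> F" "\<And>x. x \<in> D \<Longrightarrow> \<exists>U\<in>\<U>. {x, \<phi> x} \<subseteq> U"
  shows "card D \<le> matching_number E F \<U>"
proof -
  define P where "P D \<longleftrightarrow> (\<exists>\<phi>. inj_on \<phi> D \<and> \<phi> ` D \<subseteq> F \<and> (\<forall>x\<in>D. \<exists>U\<in>\<U>. {x, \<phi> x} \<subseteq> U))"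
    for D
  have "P D" unfolding P_def using assms by (intro exI[of _ \<phi>]) simp
  then have "card D \<in> {card D | D. D \<subseteq> E \<and> P D}" using assms(2) by blast
  from Max_ge[OF finite_matching_cards[OF assms(1)] this] show ?thesis
    by (simp only: matching_number_def P_def)
qed

lemma finite_card_sum_left_translate:
  fixes F :: "'a::group_add set"
  shows "finite F \<Longrightarrow> finite (left_translate g F)" "card (left_translate g F) = card F"
    "sum f (left_translate g F) = (\<Sum>x\<in>F. f (g + x))"
proof -
  have "inj_on (\<lambda>x. g + x) F" by (auto intro: inj_onI)
  then show "card (left_translate g F) = card F" "sum f (left_translate g F) = (\<Sum>x\<in>F. f (g + x))"
    by (auto simp: left_translate_def card_image sum.reindex)
qed (simp add: left_translate_def)

text \<open>
  Matched points contribute at most \<open>s\<close> to the difference of the sums and unmatched ones at most 1. The index set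
  \<open>I\<close> carries two injections so that two matchings from a common set can be composed.
\<close>

lemma sum_diff_le_of_matching:
  fixes f :: "'a \<Rightarrow> real" and s :: real
  assumes fin: "finite X" "finite Y" "finite I"
    and \<alpha>: "inj_on \<alpha> I" "\<alpha> ` I \<subseteq> X" and \<beta>: "inj_on \<beta> I" "\<beta> ` I \<subseteq> Y"
    and f: "\<And>x. 0 \<le> f x" "\<And>x. f x \<le> 1"
    and close: "\<And>i. i \<in> I \<Longrightarrow> f (\<alpha> i) - f (\<beta> i) \<le> s"
  shows "sum f X - sum f Y \<le> card X - (1 - s) * card I"
proof -
  have "sum f X = sum f (X - \<alpha> ` I) + sum f (\<alpha> ` I)"
    using fin \<alpha> by (intro sum.subset_diff) auto
  also have "sum f (X - \<alpha> ` I) \<le> of_nat (card (X - \<alpha> ` I)) * 1"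
    using f by (intro sum_bounded_above)
  also have "card (X - \<alpha> ` I) = card X - card I"
    using fin \<alpha> by (simp add: card_Diff_subset card_image)
  also have "real (card X - card I) = real (card X) - real (card I)"
    using card_inj_on_le[OF \<alpha>(1,2) fin(1)] by (simp add: of_nat_diff)
  also have "sum f (\<alpha> ` I) = (\<Sum>i\<in>I. f (\<alpha> i))"
    using \<alpha> by (simp add: sum.reindex)
  finally have X: "sum f X \<le> real (card X) - real (card I) + (\<Sum>i\<in>I. f (\<alpha> i))" by simp
  have "(\<Sum>i\<in>I. f (\<beta> i)) = sum f (\<beta> ` I)"
    using \<beta> by (simp add: sum.reindex)
  also have "\<dots> \<le> sum f Y"
    using fin \<beta> f by (intro sum_mono2) auto
  finally have Y: "(\<Sum>i\<in>I. f (\<beta> i)) \<le> sum f Y" .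
  have "(\<Sum>i\<in>I. f (\<alpha> i)) - (\<Sum>i\<in>I. f (\<beta> i)) \<le> of_nat (card I) * s"
    unfolding sum_subtractf[symmetric] using close by (intro sum_bounded_above)
  with X Y show ?thesis by (simp add: algebra_simps)
qed

lemma right_uniform_covering_of_function:
  fixes f :: "'a::topological_group_add \<Rightarrow> real"
  assumes f: "f \<in> right_UCb" and "\<epsilon> > 0" and *: "\<And>x. \<exists>V\<in>\<U>. {y. \<bar>f y - f x\<bar> \<le> \<epsilon>} \<subseteq> V"
  shows "right_uniform_covering \<U>"
proof -
  let ?U = "{u. \<forall>y. \<bar>f (u + y) - f y\<bar> \<le> \<epsilon>}"
  have "identity_neighbourhood ?U"
    using right_UCb_oscillation[OF assms(1,2)] by (simp add: identity_neighbourhood_iff_eventually)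
  moreover have "\<exists>V\<in>\<U>. (\<lambda>u. u + x) ` ?U \<subseteq> V" for x
  proof -
    obtain V where "V \<in> \<U>" "{y. \<bar>f y - f x\<bar> \<le> \<epsilon>} \<subseteq> V" using * by blast
    then show ?thesis by (intro bexI[of _ V]) auto
  qed
  ultimately show ?thesis unfolding right_uniform_covering_def by blast
qed

text \<open>
  Cover the range \<open>[0, 1]\<close> by two overlapping intervals of length \<open>2/3\<close> and pull them back: a pair of
  matched points then has values of \<open>f\<close> that differ by at most \<open>2/3\<close>.
\<close>

lemma contracts_averages_of_two_set_matchings:
  fixes G :: "'a::topological_group_add itself"
  assumes \<theta>: "0 < \<theta>" "\<theta> \<le> 1"
    and match: "\<And>(E::'a set) \<U>. finite E \<Longrightarrow> right_uniform_covering \<U> \<Longrightarrow> card \<U> = 2 \<Longrightarrow>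
      \<exists>F. finite F \<and> F \<noteq> {} \<and> (\<forall>g\<in>E. \<forall>h\<in>E.
        real (matching_number (left_translate g F) (left_translate h F) \<U>) \<ge> \<theta> * real (card F))"
  shows "contracts_averages (1 - \<theta> / 3) G"
  unfolding contracts_averages_def
proof (intro ballI allI impI)
  fix f :: "'a \<Rightarrow> real" and E :: "'a set"
  assume f: "f \<in> right_UCb" and range: "\<forall>x. 0 \<le> f x \<and> f x \<le> 1" and E: "finite E"
  define A where "A = {x. f x < 2/3}"
  define B where "B = {x. 1/3 < f x}"
  have cover: "right_uniform_covering {A, B}"
  proof (rule right_uniform_covering_of_function[OF f, of "1/10"])
    fix x
    show "\<exists>V\<in>{A, B}. {y. \<bar>f y - f x\<bar> \<le> 1/10} \<subseteq> V"
    proof (cases "f x \<le> 1/2")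
      case True
      then have "f y < 2/3" if "\<bar>f y - f x\<bar> \<le> 1/10" for y using that by linarith
      then show ?thesis by (auto simp: A_def)
    next
      case False
      then have "1/3 < f y" if "\<bar>f y - f x\<bar> \<le> 1/10" for y using that by linarith
      then show ?thesis by (auto simp: B_def)
    qed
  qed simp
  show "\<exists>F. finite F \<and> F \<noteq> {} \<and>
     (\<forall>g\<in>E. \<forall>h\<in>E. (\<Sum>x\<in>F. f (g + x)) - (\<Sum>x\<in>F. f (h + x)) \<le> (1 - \<theta> / 3) * card F)"
  \<comment> \<open>If \<open>A = B\<close>, the covering has one member only and the matching hypothesis says nothing, but then
    \<open>f\<close> takes its values in the middle third.\<close>
  proof (cases "A = B")
    case True
    have "1/3 \<le> f x \<and> f x \<le> 2/3" for x
    proof -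
      have "x \<in> A \<longleftrightarrow> x \<in> B" by (simp add: True)
      then show ?thesis unfolding A_def B_def mem_Collect_eq by linarith
    qed
    then have "f g - f h \<le> 1 - \<theta> / 3" for g h
    proof -
      have "f g \<le> 2/3" "1/3 \<le> f h" using \<open>\<And>x. 1/3 \<le> f x \<and> f x \<le> 2/3\<close> by blast+
      then show ?thesis using \<theta> by linarith
    qed
    then show ?thesis by (intro exI[of _ "{0}"]) auto
  next
    case False
    then have "card {A, B} = 2" by simp
    from match[OF E cover this] obtain F where F: "finite F" "F \<noteq> {}"
      and m: "\<And>g h. g \<in> E \<Longrightarrow> h \<in> E \<Longrightarrow>
        real (matching_number (left_translate g F) (left_translate h F) {A, B}) \<ge> \<theta> * real (card F)"
      by blast
    have "(\<Sum>x\<in>F. f (g + x)) - (\<Sum>x\<in>F. f (h + x)) \<le> (1 - \<theta> / 3) * card F"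
      if "g \<in> E" "h \<in> E" for g h
    proof -
      note fin = finite_card_sum_left_translate(1)[OF F(1)]
      obtain D \<phi> where D: "D \<subseteq> left_translate g F" "inj_on \<phi> D" "\<phi> ` D \<subseteq> left_translate h F"
        "\<forall>x\<in>D. \<exists>U\<in>{A, B}. {x, \<phi> x} \<subseteq> U"
        "card D = matching_number (left_translate g F) (left_translate h F) {A, B}"
        using matching_number_attained[OF fin, of g "left_translate h F" "{A, B}"]
        by (elim exE conjE)
      have "sum f (left_translate g F) - sum f (left_translate h F)
          \<le> card (left_translate g F) - (1 - 2/3) * card D"
      proof (rule sum_diff_le_of_matching[OF fin fin _ inj_on_id2 _ D(2,3)])
        show "finite D" using D(1) fin finite_subset by blast
        show "f x - f (\<phi> x) \<le> 2/3" if "x \<in> D" for x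
        proof -
          have "f x < 2/3 \<and> f (\<phi> x) < 2/3 \<or> 1/3 < f x \<and> 1/3 < f (\<phi> x)"
            using bspec[OF D(4) that] by (simp add: A_def B_def)
          then show ?thesis
            using range[rule_format, of x] range[rule_format, of "\<phi> x"] by linarith
        qed
      qed (use range D(1) in auto)
      also have "\<dots> \<le> (1 - \<theta> / 3) * card F"
        using m[OF that] D(5) by (simp add: finite_card_sum_left_translate algebra_simps)
      finally show ?thesis by (simp add: finite_card_sum_left_translate)
    qed
    with F show ?thesis by blast
  qed
qed

text \<open>
  Two matchings, of \<open>F\<close> with \<open>g + F\<close> and with \<open>h + F\<close>, share at least \<open>(2 * \<theta> - 1) * card F\<close> points of their
  domains, and this is where \<open>\<theta> > 1/2\<close> enters. Through a shared point, a point of \<open>g + F\<close> is linked to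
  one of \<open>h + F\<close> by two members of the covering that intersect. The three intervals are chosen such
  that the two outer ones are disjoint, so two intersecting ones have union of length at most \<open>7/10\<close>.
\<close>

lemma contracts_averages_of_three_set_matchings:
  fixes G :: "'a::topological_group_add itself"
  assumes \<theta>: "1/2 < \<theta>" "\<theta> \<le> 1"
    and match: "\<And>(E::'a set) \<U>. finite E \<Longrightarrow> right_uniform_covering \<U> \<Longrightarrow> finite \<U> \<Longrightarrow> card \<U> \<le> 3 \<Longrightarrow>
      \<exists>F. finite F \<and> F \<noteq> {} \<and> (\<forall>g\<in>E.
        real (matching_number F (left_translate g F) \<U>) \<ge> \<theta> * real (card F))"
  shows "contracts_averages (1 - (2 * \<theta> - 1) * (3/10)) G"
  unfolding contracts_averages_def
proof (intro ballI allI impI)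
  fix f :: "'a \<Rightarrow> real" and E :: "'a set"
  assume f: "f \<in> right_UCb" and range: "\<forall>x. 0 \<le> f x \<and> f x \<le> 1" and E: "finite E"
  define \<U> where "\<U> = {{x. f x < 4/10}, {x. 3/10 < f x \<and> f x < 7/10}, {x. 6/10 < f x}}"
  have cover: "right_uniform_covering \<U>"
  proof (rule right_uniform_covering_of_function[OF f, of "1/30"])
    fix x
    consider "f x \<le> 35/100" | "35/100 < f x" "f x < 65/100" | "65/100 \<le> f x" by linarith
    then show "\<exists>V\<in>\<U>. {y. \<bar>f y - f x\<bar> \<le> 1/30} \<subseteq> V"
    proof cases
      case 1
      then have "f y < 4/10" if "\<bar>f y - f x\<bar> \<le> 1/30" for y using that by linarith
      then show ?thesis unfolding \<U>_def by (intro bexI[of _ "{x. f x < 4/10}"]) auto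
    next
      case 2
      then have "3/10 < f y \<and> f y < 7/10" if "\<bar>f y - f x\<bar> \<le> 1/30" for y using that by linarith
      then show ?thesis unfolding \<U>_def by (intro bexI[of _ "{x. 3/10 < f x \<and> f x < 7/10}"]) auto
    next
      case 3
      then have "6/10 < f y" if "\<bar>f y - f x\<bar> \<le> 1/30" for y using that by linarith
      then show ?thesis unfolding \<U>_def by (intro bexI[of _ "{x. 6/10 < f x}"]) auto
    qed
  qed simp
  have "finite \<U>" "card \<U> \<le> 3"
    by (simp_all add: \<U>_def card_insert_if)
  from match[OF E cover this] obtain F where F: "finite F" "F \<noteq> {}"
    and m: "\<And>g. g \<in> E \<Longrightarrow> real (matching_number F (left_translate g F) \<U>) \<ge> \<theta> * real (card F)"
    by blast
  have "(\<Sum>x\<in>F. f (g + x)) - (\<Sum>x\<in>F. f (h + x)) \<le> (1 - (2 * \<theta> - 1) * (3/10)) * card F"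
    if g: "g \<in> E" and h: "h \<in> E" for g h
  proof -
    note fin = finite_card_sum_left_translate(1)[OF F(1)]
    obtain D \<phi> where D: "D \<subseteq> F" "inj_on \<phi> D" "\<phi> ` D \<subseteq> left_translate g F"
      "\<forall>x\<in>D. \<exists>U\<in>\<U>. {x, \<phi> x} \<subseteq> U"
      "card D = matching_number F (left_translate g F) \<U>"
      using matching_number_attained[OF F(1), of "left_translate g F" \<U>] by (elim exE conjE)
    obtain D' \<psi> where D': "D' \<subseteq> F" "inj_on \<psi> D'" "\<psi> ` D' \<subseteq> left_translate h F"
      "\<forall>x\<in>D'. \<exists>U\<in>\<U>. {x, \<psi> x} \<subseteq> U"
      "card D' = matching_number F (left_translate h F) \<U>"
      using matching_number_attained[OF F(1), of "left_translate h F" \<U>] by (elim exE conjE)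
    have finD: "finite D" "finite D'" using D(1) D'(1) F(1) finite_subset by blast+
    have "card D + card D' = card (D \<union> D') + card (D \<inter> D')"
      by (rule card_Un_Int[OF finD])
    moreover have "card (D \<union> D') \<le> card F" using D(1) D'(1) F(1) by (intro card_mono) auto
    ultimately have "real (card D) + card D' \<le> card F + card (D \<inter> D')" by linarith
    moreover have "\<theta> * card F \<le> card D" "\<theta> * card F \<le> card D'" using m[OF g] m[OF h] D(5) D'(5) by auto
    ultimately have overlap: "(2 * \<theta> - 1) * card F \<le> card (D \<inter> D')"
      by (simp add: algebra_simps)
    have "sum f (left_translate g F) - sum f (left_translate h F)
        \<le> card (left_translate g F) - (1 - 7/10) * card (D \<inter> D')"
    proof (rule sum_diff_le_of_matching[OF fin fin])
      show "inj_on \<phi> (D \<inter> D')" "inj_on \<psi> (D \<inter> D')"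
        using D(2) D'(2) by (auto intro: inj_on_subset)
      show "f (\<phi> z) - f (\<psi> z) \<le> 7/10" if "z \<in> D \<inter> D'" for z
      proof -
        define P where "P x y \<longleftrightarrow> x < 4/10 \<and> y < 4/10 \<or> 3/10 < x \<and> x < 7/10 \<and> 3/10 < y \<and> y < 7/10
          \<or> 6/10 < x \<and> 6/10 < y" for x y :: real
        have "P (f z) (f (\<phi> z))" "P (f z) (f (\<psi> z))"
          using bspec[OF D(4), of z] bspec[OF D'(4), of z] that by (simp_all add: \<U>_def P_def)
        then show ?thesis
          using range[rule_format, of "\<phi> z"] range[rule_format, of "\<psi> z"]
          unfolding P_def by linarith
      qed
    qed (use range D(3) D'(3) finD in auto)
    also have "\<dots> \<le> (1 - (2 * \<theta> - 1) * (3/10)) * card F"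
      using overlap by (simp add: finite_card_sum_left_translate algebra_simps)
    finally show ?thesis by (simp add: finite_card_sum_left_translate)
  qed
  with F show "\<exists>F. finite F \<and> F \<noteq> {} \<and> (\<forall>g\<in>E. \<forall>h\<in>E. (\<Sum>x\<in>F. f (g + x)) - (\<Sum>x\<in>F. f (h + x))
      \<le> (1 - (2 * \<theta> - 1) * (3/10)) * card F)" by blast
qed

section \<open>Equidistributed finite sets\<close>

lemma neighbourhood_with_differences_avoiding:
  fixes D :: "'a::{topological_group_add, t2_space} set"
  assumes D: "finite D" "0 \<notin> D"
  obtains V where "identity_neighbourhood V" "\<And>v w. v \<in> V \<Longrightarrow> w \<in> V \<Longrightarrow> v - w \<notin> D"
proof -
  have "open (- D)" using D(1) by (simp add: finite_imp_closed open_Compl)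
  then have "\<forall>\<^sub>F x in nhds 0. x \<notin> D"
    using D(2) by (force simp: eventually_nhds)
  then obtain Q where Q: "\<forall>\<^sub>F x in nhds (0::'a). Q x"
    "\<And>u v w. Q u \<Longrightarrow> Q v \<Longrightarrow> Q w \<Longrightarrow> u + v + w \<notin> D"
    using neighbourhood_triple_sum[of "\<lambda>x. x \<notin> D"] by metis
  have "filterlim uminus (nhds 0) (nhds (0::'a))"
    using tendsto_uminus_nhds[of "0::'a"] by simp
  from eventually_compose_filterlim[OF Q(1) this]
  have "\<forall>\<^sub>F x in nhds (0::'a). Q x \<and> Q (- x)"
    using Q(1) by (rule eventually_conj[rotated])
  then have "identity_neighbourhood {x. Q x \<and> Q (- x)}"
    by (simp add: identity_neighbourhood_iff_eventually)
  moreover have "v - w \<notin> D" if "v \<in> {x. Q x \<and> Q (- x)}" "w \<in> {x. Q x \<and> Q (- x)}" for v w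
    using Q(2)[of v 0 "- w"] that eventually_nhds_x_imp_x[OF Q(1)] by simp
  ultimately show ?thesis by (rule that)
qed

text \<open>
  In an infinite Hausdorff group, points are negligible for an invariant mean: for any number of distinct
  group elements \<open>t\<close>, a bump at \<open>p\<close> with small enough support has pairwise disjoint left translates by
  the \<open>t\<close>, and the sum of these translates is at most 1.
\<close>

lemma small_mean_bump:
  fixes \<nu> :: "('a::{topological_group_add, t2_space} \<Rightarrow> real) \<Rightarrow> real"
  assumes inf: "infinite (UNIV :: 'a set)" and \<nu>: "right_mean \<nu>"
    and inv: "\<And>f g. f \<in> right_UCb \<Longrightarrow> \<nu> (\<lambda>x. f (g + x)) = \<nu> f" and \<eta>: "(\<eta>::real) > 0"
  shows "\<exists>b. b \<in> right_UCb \<and> (\<forall>x. 0 \<le> b x) \<and> b p = 1 \<and> \<nu> b \<le> \<eta>"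
proof -
  obtain N where N: "1 / \<eta> \<le> real N" using real_arch_simple by blast
  obtain T :: "'a set" where T: "finite T" "card T = N"
    using infinite_arbitrarily_large[OF inf] by blast
  \<comment> \<open>If translates by \<open>s\<close> and \<open>t\<close> of a bump supported in \<open>V + p\<close> meet, then \<open>- t + s\<close> is a difference
    of two elements of \<open>V\<close>.\<close>
  define D where "D = (\<lambda>(s, t). - t + s) ` {(s, t) \<in> T \<times> T. s \<noteq> t}"
  have "finite D" unfolding D_def using T(1) by (intro finite_imageI) (rule finite_subset[of _ "T \<times> T"], auto)
  moreover have "0 \<notin> D"
    by (auto simp: D_def) (metis add.right_neutral add_minus_cancel)
  ultimately obtain V where V: "identity_neighbourhood V" "\<And>v w. v \<in> V \<Longrightarrow> w \<in> V \<Longrightarrow> v - w \<notin> D"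
    using neighbourhood_with_differences_avoiding by metis
  obtain b where b: "b \<in> right_UCb" "\<And>x. 0 \<le> b x" "\<And>x. b x \<le> 1" "\<And>x. x \<in> {p} \<Longrightarrow> b x = 1"
    "\<And>x. b x \<noteq> 0 \<Longrightarrow> \<exists>v\<in>V. \<exists>s\<in>{p}. x = v + s"
    using bump_function[OF V(1), of "{p}"] by metis
  have UC: "(\<lambda>x. b (- t + x)) \<in> right_UCb" for t by (rule right_UCb_left_translate[OF b(1)])
  have disjoint: "s = t" if st: "s \<in> T" "t \<in> T" "b (- s + x) \<noteq> 0" "b (- t + x) \<noteq> 0" for s t x
  proof (rule ccontr)
    assume "s \<noteq> t"
    obtain v w where vw: "v \<in> V" "w \<in> V" "- s + x = v + p" "- t + x = w + p"
      using b(5)[OF st(3)] b(5)[OF st(4)] by auto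
    have "w - v = (w + p) - (v + p)" by (simp add: diff_conv_add_uminus minus_add add.assoc del: add_uminus_conv_diff)
    also have "\<dots> = (- t + x) - (- s + x)" using vw by simp
    also have "\<dots> = - t + s" by (simp add: diff_conv_add_uminus minus_add add.assoc del: add_uminus_conv_diff)
    finally have "w - v \<in> D" using st \<open>s \<noteq> t\<close> by (auto simp: D_def intro!: image_eqI[of _ _ "(s, t)"])
    with V(2)[OF vw(2,1)] show False by simp
  qed
  have "(\<Sum>t\<in>T. b (- t + x)) \<le> 1" for x
  proof (cases "\<exists>s\<in>T. b (- s + x) \<noteq> 0")
    case True
    then obtain s where s: "s \<in> T" "b (- s + x) \<noteq> 0" by blast
    have "(\<Sum>t\<in>T. b (- t + x)) = b (- s + x) + (\<Sum>t\<in>T - {s}. b (- t + x))"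
      by (rule sum.remove[OF T(1) s(1)])
    also have "(\<Sum>t\<in>T - {s}. b (- t + x)) = 0"
      using disjoint[OF _ s(1) _ s(2)] by (intro sum.neutral) blast
    finally show ?thesis using b(3) by simp
  qed simp
  then have "\<nu> (\<lambda>x. \<Sum>t\<in>T. b (- t + x)) \<le> 1"
    by (rule mean_upper[OF \<nu> right_UCb_sum[OF UC]])
  then have "N * \<nu> b \<le> 1"
    by (simp add: mean_sum[OF \<nu> UC] inv[OF b(1)] T(2))
  moreover have "1 \<le> N * \<eta>" using N \<eta> by (simp add: field_simps)
  ultimately have "N * \<nu> b \<le> N * \<eta>" by linarith
  moreover have "N > 0" using N \<eta> by (metis divide_pos_pos gr0I leD of_nat_0 zero_less_one)
  ultimately have "\<nu> b \<le> \<eta>" by simp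
  with b(1,2,4) show ?thesis by (intro exI[of _ b]) auto
qed

text \<open>
  The weighted sum \<open>h\<close> of the functions \<open>\<phi> - \<nu> \<phi>\<close> has mean 0, so it takes values below any positive number.
  Adding a large multiple of bumps at the points of \<open>F\<close> with tiny total mean makes the function exceed 1
  on \<open>F\<close> and keeps the mean small, so a point with a small value can be found outside \<open>F\<close>.
\<close>

lemma equidistribution_step:
  fixes \<nu> :: "('a::{topological_group_add, t2_space} \<Rightarrow> real) \<Rightarrow> real"
  assumes inf: "infinite (UNIV :: 'a set)" and \<nu>: "right_mean \<nu>"
    and inv: "\<And>f g. f \<in> right_UCb \<Longrightarrow> \<nu> (\<lambda>x. f (g + x)) = \<nu> f"
    and F: "finite F" and \<Phi>: "\<Phi> \<subseteq> right_UCb"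
  shows "\<exists>x. x \<notin> F \<and> (\<Sum>\<phi>\<in>\<Phi>. w \<phi> * (\<phi> x - \<nu> \<phi>)) \<le> 1"
proof -
  define h where "h x = (\<Sum>\<phi>\<in>\<Phi>. w \<phi> * (\<phi> x - \<nu> \<phi>))" for x
  have UC: "(\<lambda>x. w \<phi> * (\<phi> x - \<nu> \<phi>)) \<in> right_UCb" if "\<phi> \<in> \<Phi>" for \<phi>
    using \<Phi> that by (intro right_UCb_scale right_UCb_diff right_UCb_const) blast
  have hUC: "h \<in> right_UCb" unfolding h_def by (rule right_UCb_sum) (rule UC)
  have "\<nu> (\<lambda>x. w \<phi> * (\<phi> x - \<nu> \<phi>)) = 0" if "\<phi> \<in> \<Phi>" for \<phi>
  proof -
    have \<phi>: "\<phi> \<in> right_UCb" using \<Phi> that by blast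
    show ?thesis
      by (simp only: mean_scale[OF \<nu> right_UCb_diff[OF \<phi> right_UCb_const]]
          mean_diff[OF \<nu> \<phi> right_UCb_const] mean_const[OF \<nu>]) simp
  qed
  then have h0: "\<nu> h = 0" unfolding h_def by (subst mean_sum[OF \<nu> UC]) auto
  obtain B where B: "B \<ge> 0" "\<And>x. \<bar>h x\<bar> \<le> B" using right_UCb_bound[OF hUC] by blast
  define K where "K = B + 1"
  have K: "K > 0" using B(1) by (simp add: K_def)
  define \<eta> where "\<eta> = 1 / (2 * K * (card F + 1))"
  have \<eta>: "\<eta> > 0" using K by (simp add: \<eta>_def)
  obtain b where b: "\<And>p. b p \<in> right_UCb" "\<And>p x. 0 \<le> b p x" "\<And>p. b p p = 1" "\<And>p. \<nu> (b p) \<le> \<eta>"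
    using small_mean_bump[OF inf \<nu> inv \<eta>] by metis
  define s where "s x = (\<Sum>p\<in>F. b p x)" for x
  have sUC: "s \<in> right_UCb" unfolding s_def by (rule right_UCb_sum) (rule b(1))
  have "\<nu> s = (\<Sum>p\<in>F. \<nu> (b p))" unfolding s_def by (rule mean_sum[OF \<nu> b(1)])
  also have "\<dots> \<le> card F * \<eta>" using b(4) by (intro sum_bounded_above)
  also have "\<dots> \<le> (card F + 1) * \<eta>" using \<eta> by (intro mult_right_mono) auto
  also have "\<dots> = 1 / (2 * K)" by (simp add: \<eta>_def)
  finally have "K * \<nu> s \<le> 1/2" using K by (simp add: field_simps)
  moreover have "\<nu> (\<lambda>x. h x + K * s x) = K * \<nu> s"
    by (simp add: mean_add[OF \<nu> hUC right_UCb_scale[OF sUC]] mean_scale[OF \<nu> sUC] h0)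
  ultimately obtain x where x: "h x + K * s x < 1"
    using mean_less_imp_point[OF \<nu> right_UCb_add[OF hUC right_UCb_scale[OF sUC]], of K 1] by auto
  have s_nonneg: "0 \<le> s x" unfolding s_def by (intro sum_nonneg) (rule b(2))
  have "x \<notin> F"
  proof
    assume "x \<in> F"
    then have "1 \<le> s x"
      using member_le_sum[of x F "\<lambda>p. b p x"] F b(2,3) by (simp add: s_def)
    then have "K \<le> K * s x" using K by simp
    then show False using x B(2)[of x] by (simp add: K_def abs_le_iff)
  qed
  moreover have "h x \<le> 1"
    using x mult_nonneg_nonneg[OF less_imp_le[OF K] s_nonneg] by linarith
  ultimately show ?thesis unfolding h_def by blast
qed

text \<open>
  Add points greedily. If the deviation vector \<open>w\<close> has components \<open>sum \<phi> F - card F * \<nu> \<phi>\<close>, choosing the new point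
  with almost nonpositive inner product with \<open>w\<close> lets the squared norm of \<open>w\<close> grow by at most a constant \<open>C\<close>.
  After \<open>n\<close> steps the norm is at most \<open>sqrt (n * C)\<close>, which is small compared to \<open>n\<close>. This yields distinct points
  with equal weights directly, in place of separating the mean from convex combinations of point masses.
\<close>

lemma equidistributed_sets:
  fixes \<nu> :: "('a::{topological_group_add, t2_space} \<Rightarrow> real) \<Rightarrow> real" and \<epsilon> :: real
  assumes inf: "infinite (UNIV :: 'a set)" and \<nu>: "right_mean \<nu>"
    and inv: "\<And>f g. f \<in> right_UCb \<Longrightarrow> \<nu> (\<lambda>x. f (g + x)) = \<nu> f"
    and \<Phi>: "finite \<Phi>" "\<Phi> \<subseteq> right_UCb" and \<epsilon>: "\<epsilon> > 0"
  shows "\<exists>F. finite F \<and> m \<le> card F \<and> (\<forall>\<phi>\<in>\<Phi>. \<bar>sum \<phi> F - card F * \<nu> \<phi>\<bar> \<le> \<epsilon> * card F)"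
proof -
  have "\<exists>B. \<forall>\<phi>\<in>\<Phi>. \<forall>x. \<bar>\<phi> x - \<nu> \<phi>\<bar> \<le> B"
  proof -
    have "\<exists>C. \<forall>x. \<bar>\<phi> x - \<nu> \<phi>\<bar> \<le> C" if "\<phi> \<in> \<Phi>" for \<phi>
      using right_UCb_bound[OF right_UCb_diff[OF _ right_UCb_const], of \<phi> "\<nu> \<phi>"] \<Phi>(2) that by blast
    then obtain C where C: "\<And>\<phi> x. \<phi> \<in> \<Phi> \<Longrightarrow> \<bar>\<phi> x - \<nu> \<phi>\<bar> \<le> C \<phi>" by metis
    have "\<bar>\<phi> x - \<nu> \<phi>\<bar> \<le> (\<Sum>\<phi>\<in>\<Phi>. C \<phi>)" if "\<phi> \<in> \<Phi>" for \<phi> x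
    proof -
      have "0 \<le> C \<psi>" if "\<psi> \<in> \<Phi>" for \<psi> using C[OF that, of 0] by linarith
      then have "C \<phi> \<le> (\<Sum>\<phi>\<in>\<Phi>. C \<phi>)" using \<Phi>(1) that by (intro member_le_sum) auto
      then show ?thesis using C[OF that, of x] by linarith
    qed
    then show ?thesis by blast
  qed
  then obtain B where B: "\<And>\<phi> x. \<phi> \<in> \<Phi> \<Longrightarrow> \<bar>\<phi> x - \<nu> \<phi>\<bar> \<le> B" by blast
  define C where "C = 2 + card \<Phi> * B\<^sup>2"
  have C: "C > 0" by (simp add: C_def add_pos_nonneg)
  have step: "\<exists>F. finite F \<and> card F = n \<and> (\<Sum>\<phi>\<in>\<Phi>. (sum \<phi> F - card F * \<nu> \<phi>)\<^sup>2) \<le> n * C" for n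
  proof (induction n)
    case 0
    show ?case by (intro exI[of _ "{}"]) simp
  next
    case (Suc n)
    then obtain F where F: "finite F" "card F = n"
      and IH: "(\<Sum>\<phi>\<in>\<Phi>. (sum \<phi> F - card F * \<nu> \<phi>)\<^sup>2) \<le> n * C" by blast
    define w where "w \<phi> = sum \<phi> F - card F * \<nu> \<phi>" for \<phi>
    obtain x where x: "x \<notin> F" "(\<Sum>\<phi>\<in>\<Phi>. w \<phi> * (\<phi> x - \<nu> \<phi>)) \<le> 1"
      using equidistribution_step[OF inf \<nu> inv F(1) \<Phi>(2)] by blast
    have "sum \<phi> (insert x F) - card (insert x F) * \<nu> \<phi> = w \<phi> + (\<phi> x - \<nu> \<phi>)" for \<phi>
      using F x(1) by (simp add: w_def algebra_simps)
    then have "(\<Sum>\<phi>\<in>\<Phi>. (sum \<phi> (insert x F) - card (insert x F) * \<nu> \<phi>)\<^sup>2)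
        = (\<Sum>\<phi>\<in>\<Phi>. (w \<phi>)\<^sup>2 + 2 * (w \<phi> * (\<phi> x - \<nu> \<phi>)) + (\<phi> x - \<nu> \<phi>)\<^sup>2)"
      by (simp add: power2_sum mult.assoc add_ac)
    also have "\<dots> = (\<Sum>\<phi>\<in>\<Phi>. (w \<phi>)\<^sup>2) + 2 * (\<Sum>\<phi>\<in>\<Phi>. w \<phi> * (\<phi> x - \<nu> \<phi>)) + (\<Sum>\<phi>\<in>\<Phi>. (\<phi> x - \<nu> \<phi>)\<^sup>2)"
      by (simp add: sum.distrib sum_distrib_left)
    also have "(\<Sum>\<phi>\<in>\<Phi>. (\<phi> x - \<nu> \<phi>)\<^sup>2) \<le> card \<Phi> * B\<^sup>2"
    proof (rule sum_bounded_above)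
      fix \<phi> assume "\<phi> \<in> \<Phi>"
      from power_mono[OF B[OF this, of x], of 2] show "(\<phi> x - \<nu> \<phi>)\<^sup>2 \<le> B\<^sup>2" by simp
    qed
    finally have le: "(\<Sum>\<phi>\<in>\<Phi>. (sum \<phi> (insert x F) - card (insert x F) * \<nu> \<phi>)\<^sup>2)
        \<le> (\<Sum>\<phi>\<in>\<Phi>. (w \<phi>)\<^sup>2) + 2 * (\<Sum>\<phi>\<in>\<Phi>. w \<phi> * (\<phi> x - \<nu> \<phi>)) + card \<Phi> * B\<^sup>2" by simp
    have "real (Suc n) * C = n * C + 2 + card \<Phi> * B\<^sup>2" by (simp add: C_def algebra_simps)
    then have "(\<Sum>\<phi>\<in>\<Phi>. (sum \<phi> (insert x F) - card (insert x F) * \<nu> \<phi>)\<^sup>2) \<le> Suc n * C"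
      using IH[folded w_def] x(2) le by linarith
    then show ?case using F x(1) by (intro exI[of _ "insert x F"]) simp
  qed
  obtain N where N: "C / \<epsilon>\<^sup>2 \<le> real N" using real_arch_simple by blast
  define n where "n = max N m"
  obtain F where F: "finite F" "card F = n"
    and Q: "(\<Sum>\<phi>\<in>\<Phi>. (sum \<phi> F - card F * \<nu> \<phi>)\<^sup>2) \<le> n * C" using step by blast
  have "\<bar>sum \<phi> F - card F * \<nu> \<phi>\<bar> \<le> \<epsilon> * card F" if "\<phi> \<in> \<Phi>" for \<phi>
  proof (rule power2_le_imp_le)
    have "(sum \<phi> F - card F * \<nu> \<phi>)\<^sup>2 \<le> (\<Sum>\<phi>\<in>\<Phi>. (sum \<phi> F - card F * \<nu> \<phi>)\<^sup>2)"
      using \<Phi>(1) that by (intro member_le_sum) auto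
    also note Q
    also have "real n * C \<le> real n * (real n * \<epsilon>\<^sup>2)"
    proof (rule mult_left_mono)
      have "C / \<epsilon>\<^sup>2 \<le> n" using N by (simp add: n_def)
      then show "C \<le> real n * \<epsilon>\<^sup>2" using \<epsilon> by (simp add: field_simps)
    qed simp
    also have "\<dots> = (\<epsilon> * card F)\<^sup>2" by (simp add: F(2) power2_eq_square)
    finally show "\<bar>sum \<phi> F - card F * \<nu> \<phi>\<bar>\<^sup>2 \<le> (\<epsilon> * card F)\<^sup>2" by simp
    show "0 \<le> \<epsilon> * card F" using \<epsilon> by simp
  qed
  with F show ?thesis by (intro exI[of _ F]) (simp add: n_def)
qed

section \<open>Matchings from equidistributed sets\<close>

text \<open>
  From bumps \<open>a\<close> and \<open>b\<close> that are 1 at the points whose \<open>V\<close>-neighbourhood lies in \<open>A\<close> and in \<open>B\<close> respectively,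
  the functions \<open>a\<close>, \<open>max a b - a\<close> and \<open>1 - max a b\<close> form the partition. Where the last one is nonzero,
  neither \<open>A\<close> nor \<open>B\<close> contains the \<open>V\<close>-neighbourhood of the point, hence \<open>C\<close> does.
\<close>

lemma partition_subordinate_to_three_sets:
  fixes A B C :: "'a::topological_group_add set"
  assumes "right_uniform_covering {A, B, C}"
  obtains p q r :: "'a \<Rightarrow> real" where "p \<in> right_UCb" "q \<in> right_UCb" "r \<in> right_UCb"
    "\<And>x. 0 \<le> p x" "\<And>x. 0 \<le> q x" "\<And>x. 0 \<le> r x" "\<And>x. p x + q x + r x = 1"
    "\<And>x. p x \<noteq> 0 \<Longrightarrow> x \<in> A" "\<And>x. q x \<noteq> 0 \<Longrightarrow> x \<in> B" "\<And>x. r x \<noteq> 0 \<Longrightarrow> x \<in> C"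
proof -
  obtain V where V: "identity_neighbourhood V" "\<And>x. \<exists>W\<in>{A, B, C}. (\<lambda>u. u + x) ` V \<subseteq> W"
    using assms unfolding right_uniform_covering_def by blast
  have "0 \<in> V"
    by (rule zero_in_identity_neighbourhood[OF V(1)])
  have bump: "\<exists>a\<in>right_UCb. (\<forall>x. 0 \<le> a x \<and> a x \<le> 1) \<and> (\<forall>x. (\<lambda>u. u + x) ` V \<subseteq> S \<longrightarrow> a x = 1) \<and>
      (\<forall>x. a x \<noteq> 0 \<longrightarrow> x \<in> S)" for S
  proof -
    define T where "T = {s. (\<lambda>u. u + s) ` V \<subseteq> S}"
    obtain a where a: "a \<in> right_UCb" "\<And>x. 0 \<le> a x" "\<And>x. a x \<le> 1" "\<And>x. x \<in> T \<Longrightarrow> a x = 1"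
      "\<And>x. a x \<noteq> 0 \<Longrightarrow> \<exists>v\<in>V. \<exists>s\<in>T. x = v + s"
      using bump_function[OF V(1), of T] by metis
    have "x \<in> S" if "a x \<noteq> 0" for x using a(5)[OF that] by (auto simp: T_def)
    with a(1-4) show ?thesis by (intro bexI[of _ a]) (auto simp: T_def)
  qed
  obtain a where a: "a \<in> right_UCb" "\<And>x. 0 \<le> a x \<and> a x \<le> 1"
    "\<And>x. (\<lambda>u. u + x) ` V \<subseteq> A \<Longrightarrow> a x = 1" "\<And>x. a x \<noteq> 0 \<Longrightarrow> x \<in> A"
    using bump[of A] by blast
  obtain b where b: "b \<in> right_UCb" "\<And>x. 0 \<le> b x \<and> b x \<le> 1"
    "\<And>x. (\<lambda>u. u + x) ` V \<subseteq> B \<Longrightarrow> b x = 1" "\<And>x. b x \<noteq> 0 \<Longrightarrow> x \<in> B"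
    using bump[of B] by blast
  show ?thesis
  proof (rule that[of a "\<lambda>x. max (a x) (b x) - a x" "\<lambda>x. 1 - max (a x) (b x)"])
    show "a \<in> right_UCb" by (rule a(1))
    show "(\<lambda>x. max (a x) (b x) - a x) \<in> right_UCb"
      by (rule right_UCb_diff[OF right_UCb_max[OF a(1) b(1)] a(1)])
    show "(\<lambda>x. 1 - max (a x) (b x)) \<in> right_UCb"
      by (rule right_UCb_diff[OF right_UCb_const right_UCb_max[OF a(1) b(1)]])
    show "x \<in> A" if "a x \<noteq> 0" for x using a(4) that .
    show "x \<in> B" if "max (a x) (b x) - a x \<noteq> 0" for x
    proof (rule b(4))
      show "b x \<noteq> 0" using that a(2)[of x] by (auto simp: max_def split: if_splits)
    qed
    show "x \<in> C" if "1 - max (a x) (b x) \<noteq> 0" for x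
    proof -
      have "\<not> (\<lambda>u. u + x) ` V \<subseteq> A" "\<not> (\<lambda>u. u + x) ` V \<subseteq> B"
        using a(2,3)[of x] b(2,3)[of x] that by (auto simp: max_def split: if_splits)
      then have "(\<lambda>u. u + x) ` V \<subseteq> C" using V(2)[of x] by simp
      with \<open>0 \<in> V\<close> show ?thesis by force
    qed
  qed (use a(2) b(2) in auto)
qed

text \<open>
  Hall's theorem for two classes: fill the part of size \<open>m\<close> from points outside \<open>B\<close> as far as possible.
\<close>

lemma disjoint_subsets_of_given_sizes:
  assumes X: "finite X" and "m \<le> card (X \<inter> A)" "n \<le> card (X \<inter> B)" "m + n \<le> card (X \<inter> (A \<union> B))"
  obtains S T where "S \<subseteq> X \<inter> A" "T \<subseteq> X \<inter> B" "S \<inter> T = {}" "card S = m" "card T = n"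
proof (cases "m \<le> card (X \<inter> (A - B))")
  case True
  obtain S where S: "S \<subseteq> X \<inter> (A - B)" "card S = m"
    using obtain_subset_with_card_n[OF True] by metis
  obtain T where T: "T \<subseteq> X \<inter> B" "card T = n"
    using obtain_subset_with_card_n[OF assms(3)] by metis
  show ?thesis by (rule that[OF _ T(1) _ S(2) T(2)]) (use S(1) T(1) in blast)+
next
  case False
  then obtain S where S: "X \<inter> (A - B) \<subseteq> S" "S \<subseteq> X \<inter> A" "card S = m"
    using exists_subset_between[of "X \<inter> (A - B)" m "X \<inter> A"] assms(2) X by auto
  have "card (X \<inter> (A \<union> B) - S) = card (X \<inter> (A \<union> B)) - m"
    using S(2,3) X by (subst card_Diff_subset) (auto intro: finite_subset)
  then have "n \<le> card (X \<inter> (A \<union> B) - S)" using assms(4) by simp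
  then obtain T where T: "T \<subseteq> X \<inter> (A \<union> B) - S" "card T = n"
    using obtain_subset_with_card_n by metis
  show ?thesis by (rule that[OF S(2) _ _ S(3) T(2)]) (use S(1) T(1) in blast)+
qed

lemma matching_number_two_sets:
  assumes "finite X" "finite Y" "A \<in> \<U>" "B \<in> \<U>"
    and X: "m \<le> card (X \<inter> A)" "n \<le> card (X \<inter> B)" "m + n \<le> card (X \<inter> (A \<union> B))"
    and Y: "m \<le> card (Y \<inter> A)" "n \<le> card (Y \<inter> B)" "m + n \<le> card (Y \<inter> (A \<union> B))"
  shows "m + n \<le> matching_number X Y \<U>"
proof -
  obtain S T where ST: "S \<subseteq> X \<inter> A" "T \<subseteq> X \<inter> B" "S \<inter> T = {}" "card S = m" "card T = n"
    using disjoint_subsets_of_given_sizes[OF assms(1) X] by metis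
  obtain S' T' where ST': "S' \<subseteq> Y \<inter> A" "T' \<subseteq> Y \<inter> B" "S' \<inter> T' = {}" "card S' = m" "card T' = n"
    using disjoint_subsets_of_given_sizes[OF assms(2) Y] by metis
  have fin: "finite S" "finite T" "finite S'" "finite T'"
    using ST(1,2) ST'(1,2) assms(1,2) by (meson finite_Int finite_subset)+
  obtain f where f: "bij_betw f S S'"
    using finite_same_card_bij[OF fin(1,3)] ST(4) ST'(4) by auto
  obtain g where g: "bij_betw g T T'"
    using finite_same_card_bij[OF fin(2,4)] ST(5) ST'(5) by auto
  define \<phi> where "\<phi> x = (if x \<in> S then f x else g x)" for x
  have \<phi>S: "bij_betw \<phi> S S'" using f by (subst bij_betw_cong[of _ _ f]) (auto simp: \<phi>_def)
  have \<phi>T: "bij_betw \<phi> T T'" using g ST(3) by (subst bij_betw_cong[of _ _ g]) (auto simp: \<phi>_def)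
  have \<phi>: "bij_betw \<phi> (S \<union> T) (S' \<union> T')"
    by (rule bij_betw_combine[OF \<phi>S \<phi>T ST'(3)])
  have "card (S \<union> T) \<le> matching_number X Y \<U>"
  proof (rule matching_number_ge[OF assms(1)])
    show "inj_on \<phi> (S \<union> T)" using \<phi> by (rule bij_betw_imp_inj_on)
    show "\<phi> ` (S \<union> T) \<subseteq> Y" using bij_betw_imp_surj_on[OF \<phi>] ST'(1,2) by auto
    show "S \<union> T \<subseteq> X" using ST(1,2) by blast
    fix x assume "x \<in> S \<union> T"
    then show "\<exists>U\<in>\<U>. {x, \<phi> x} \<subseteq> U"
    proof
      assume "x \<in> S"
      then have "x \<in> A" "\<phi> x \<in> A" using ST(1) ST'(1) bij_betwE[OF \<phi>S] by auto
      then show ?thesis using assms(3) by blast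
    next
      assume "x \<in> T"
      then have "x \<in> B" "\<phi> x \<in> B" using ST(2) ST'(2) bij_betwE[OF \<phi>T] by auto
      then show ?thesis using assms(4) by blast
    qed
  qed
  then show ?thesis using ST(3-5) fin by (simp add: card_Un_disjoint)
qed

lemma sum_le_card_support:
  fixes p :: "'a \<Rightarrow> real"
  assumes "finite X" "\<And>x. p x \<le> 1" "\<And>x. p x \<noteq> 0 \<Longrightarrow> x \<in> A"
  shows "sum p X \<le> card (X \<inter> A)"
proof -
  have "sum p X = sum p (X \<inter> A)"
    using assms by (intro sum.mono_neutral_right) auto
  also have "\<dots> \<le> of_nat (card (X \<inter> A)) * 1"
    using assms(2) by (intro sum_bounded_above)
  finally show ?thesis by simp
qed

text \<open>
  The averages of \<open>p\<close>, \<open>q\<close> and \<open>p + q\<close> bound from below how much of \<open>X\<close> and of \<open>Y\<close> lies in \<open>A\<close>, \<open>B\<close> and \<open>A \<union> B\<close>. Errors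
  of \<open>n / 100\<close> twice and rounding down twice cost at most \<open>n / 50 + 2 \<le> n / 25\<close>, which fits between \<open>3/5\<close> and \<open>2/3\<close>.
\<close>

lemma matching_number_of_equal_averages:
  fixes p q :: "'a \<Rightarrow> real"
  assumes fin: "finite X" "finite Y" and card: "card X = n" "card Y = n" and n: "100 \<le> n"
    and AB: "A \<in> \<U>" "B \<in> \<U>"
    and nonneg: "\<And>x. 0 \<le> p x" "\<And>x. 0 \<le> q x" and le: "\<And>x. p x + q x \<le> 1"
    and supp: "\<And>x. p x \<noteq> 0 \<Longrightarrow> x \<in> A" "\<And>x. q x \<noteq> 0 \<Longrightarrow> x \<in> B"
    and p: "\<And>Z. Z \<in> {X, Y} \<Longrightarrow> \<bar>sum p Z - n * a\<bar> \<le> n / 100"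
    and q: "\<And>Z. Z \<in> {X, Y} \<Longrightarrow> \<bar>sum q Z - n * b\<bar> \<le> n / 100"
    and ab: "2/3 \<le> a + b"
  shows "3/5 * n \<le> matching_number X Y \<U>"
proof -
  define k where "k = nat \<lfloor>n * a - n / 100\<rfloor>"
  define l where "l = nat \<lfloor>n * b - n / 100\<rfloor>"
  have room: "k \<le> card (Z \<inter> A) \<and> l \<le> card (Z \<inter> B) \<and> k + l \<le> card (Z \<inter> (A \<union> B))"
    if Z: "Z \<in> {X, Y}" for Z
  proof -
    have finZ: "finite Z" using Z fin by auto
    have "0 \<le> sum p Z" "0 \<le> sum q Z" using nonneg by (auto intro: sum_nonneg)
    then have k: "k \<le> sum p Z" and l: "l \<le> sum q Z"
      using p[OF Z] q[OF Z] unfolding k_def l_def by linarith+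
    have "sum p Z \<le> card (Z \<inter> A)"
      using nonneg(2) le by (intro sum_le_card_support[OF finZ _ supp(1)]) (smt (verit))
    moreover have "sum q Z \<le> card (Z \<inter> B)"
      using nonneg(1) le by (intro sum_le_card_support[OF finZ _ supp(2)]) (smt (verit))
    moreover have "(\<Sum>x\<in>Z. p x + q x) \<le> card (Z \<inter> (A \<union> B))"
      by (rule sum_le_card_support[OF finZ le]) (use supp in force)
    ultimately show ?thesis using k l by (simp add: sum.distrib)
  qed
  have "n * a + n * b \<ge> 2/3 * n" using mult_left_mono[OF ab, of n] by (simp add: algebra_simps)
  moreover have "real k \<ge> n * a - n / 100 - 1" "real l \<ge> n * b - n / 100 - 1"
    unfolding k_def l_def by linarith+
  ultimately have "3/5 * n \<le> k + l" using n by simp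
  also have "k + l \<le> matching_number X Y \<U>"
    using room[of X] room[of Y] by (intro matching_number_two_sets[OF fin AB]) auto
  finally show ?thesis by simp
qed

lemma left_translate_UNIV: "left_translate g (UNIV :: 'a::group_add set) = UNIV"
  unfolding left_translate_def by (metis add_minus_cancel surjI)

text \<open>
  The means of a three-function partition of unity add up to 1, so two of them add up to at least \<open>2/3\<close>, and
  matching within the two corresponding members of the covering suffices for \<open>3/5 > 1/2\<close>. If the group
  is finite, where points are not negligible, \<open>F = UNIV\<close> is invariant.
\<close>

lemma matchings_of_amenable:
  fixes G :: "'a::{topological_group_add, t2_space} itself" and E :: "'a set"
  assumes "amenable G" and cover: "right_uniform_covering \<U>" and "finite \<U>" "card \<U> \<le> 3"
    and E: "finite E"
  shows "\<exists>F. finite F \<and> F \<noteq> {} \<and> (\<forall>g\<in>E. \<forall>h\<in>E.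
    real (matching_number (left_translate g F) (left_translate h F) \<U>) \<ge> 3/5 * real (card F))"
proof (cases "finite (UNIV :: 'a set)")
  case True
  have covers: "\<exists>U\<in>\<U>. x \<in> U" for x
  proof -
    obtain V W where "identity_neighbourhood V" and W: "W \<in> \<U>" "(\<lambda>u. u + x) ` V \<subseteq> W"
      using cover unfolding right_uniform_covering_def by blast
    then have "0 + x \<in> W"
      using zero_in_identity_neighbourhood by blast
    then show ?thesis using W(1) by auto
  qed
  have "card (UNIV :: 'a set) \<le> matching_number UNIV UNIV \<U>"
    by (rule matching_number_ge[OF True, of UNIV id]) (simp_all add: covers)
  then have "3/5 * real (card (UNIV :: 'a set)) \<le> matching_number UNIV UNIV \<U>" by simp
  then show ?thesis
    by (intro exI[of _ UNIV]) (simp add: left_translate_UNIV True)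
next
  case False
  obtain \<nu> :: "('a \<Rightarrow> real) \<Rightarrow> real" where \<nu>: "right_mean \<nu>"
    and "\<forall>f\<in>right_UCb. \<forall>g. \<nu> (f \<circ> (\<lambda>x. g + x)) = \<nu> f"
    using assms(1) unfolding amenable_def by blast
  then have inv: "\<nu> (\<lambda>x. f (g + x)) = \<nu> f" if "f \<in> right_UCb" for f g
    using that by (simp add: comp_def)
  have "\<U> \<noteq> {}" using cover unfolding right_uniform_covering_def by blast
  then have "card \<U> \<noteq> 0" using assms(3) by simp
  then consider "card \<U> = 1" | "card \<U> = 2" | "card \<U> = 3"
    using assms(4) by linarith
  then have "\<exists>A B C. \<U> = {A, B, C}"
  proof cases
    case 1
    then obtain A where "\<U> = {A}" by (rule card_1_singletonE)
    then have "\<U> = {A, A, A}" by simp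
    then show ?thesis by blast
  next
    case 2
    then obtain A B where "\<U> = {A, B, B}" by (auto simp: card_2_iff)
    then show ?thesis by blast
  next
    case 3
    then show ?thesis by (auto simp: card_3_iff)
  qed
  then obtain A B C where U: "\<U> = {A, B, C}" by blast
  obtain p q r :: "'a \<Rightarrow> real" where UC: "p \<in> right_UCb" "q \<in> right_UCb" "r \<in> right_UCb"
    and nonneg: "\<And>x. 0 \<le> p x" "\<And>x. 0 \<le> q x" "\<And>x. 0 \<le> r x"
    and one: "\<And>x. p x + q x + r x = 1"
    and supp: "\<And>x. p x \<noteq> 0 \<Longrightarrow> x \<in> A" "\<And>x. q x \<noteq> 0 \<Longrightarrow> x \<in> B" "\<And>x. r x \<noteq> 0 \<Longrightarrow> x \<in> C"
    using partition_subordinate_to_three_sets[OF cover[unfolded U]] by metis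
  have "\<nu> p + \<nu> q + \<nu> r = \<nu> (\<lambda>x. p x + q x + r x)"
    by (simp only: mean_add[OF \<nu> UC(1,2)] mean_add[OF \<nu> right_UCb_add[OF UC(1,2)] UC(3)])
  then have total: "\<nu> p + \<nu> q + \<nu> r = 1" using one by (simp add: mean_const[OF \<nu>])
  define \<Phi> where "\<Phi> = (\<lambda>(f, g) x. f (g + x)) ` ({p, q, r} \<times> E)"
  have "finite \<Phi>" "\<Phi> \<subseteq> right_UCb"
    using E UC by (auto simp: \<Phi>_def intro: right_UCb_left_translate)
  from equidistributed_sets[OF False \<nu> inv this, of "1/100" 100]
  obtain F where F: "finite F" "100 \<le> card F"
    and av: "\<And>\<phi>. \<phi> \<in> \<Phi> \<Longrightarrow> \<bar>sum \<phi> F - card F * \<nu> \<phi>\<bar> \<le> 1/100 * card F"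
    by auto
  have avg: "\<bar>sum f (left_translate g F) - card F * \<nu> f\<bar> \<le> card F / 100"
    if "f \<in> {p, q, r}" "g \<in> E" for f g
  proof -
    have "(\<lambda>x. f (g + x)) \<in> \<Phi>"
      unfolding \<Phi>_def using that by (intro image_eqI[of _ _ "(f, g)"]) auto
    moreover have "f \<in> right_UCb" using that UC by auto
    ultimately show ?thesis using av[of "\<lambda>x. f (g + x)"] by (simp add: inv finite_card_sum_left_translate)
  qed
  have "3/5 * real (card F) \<le> matching_number (left_translate g F) (left_translate h F) \<U>"
    if gh: "g \<in> E" "h \<in> E" for g h
  proof -
    note fin = finite_card_sum_left_translate(1)[OF F(1)]
    note base = matching_number_of_equal_averages[OF fin fin finite_card_sum_left_translate(2,2) F(2)]
    consider "2/3 \<le> \<nu> p + \<nu> q" | "2/3 \<le> \<nu> p + \<nu> r" | "2/3 \<le> \<nu> q + \<nu> r"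
      using total by linarith
    then show ?thesis
    proof cases
      case 1
      show ?thesis
      proof (rule base[OF _ _ nonneg(1,2) _ supp(1,2) _ _ 1])
        show "p x + q x \<le> 1" for x using one[of x] nonneg(3)[of x] by linarith
      qed (use gh U avg in auto)
    next
      case 2
      show ?thesis
      proof (rule base[OF _ _ nonneg(1,3) _ supp(1,3) _ _ 2])
        show "p x + r x \<le> 1" for x using one[of x] nonneg(2)[of x] by linarith
      qed (use gh U avg in auto)
    next
      case 3
      show ?thesis
      proof (rule base[OF _ _ nonneg(2,3) _ supp(2,3) _ _ 3])
        show "q x + r x \<le> 1" for x using one[of x] nonneg(1)[of x] by linarith
      qed (use gh U avg in auto)
    qed
  qed
  moreover have "F \<noteq> {}" using F(2) by auto
  ultimately show ?thesis using F(1) by blast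
qed

theorem corollary6p5:
  fixes G :: "'a::{topological_group_add, t2_space} itself"
  shows
    "(amenable G \<longleftrightarrow>
       (\<exists>\<theta>::real. 1/2 < \<theta> \<and> \<theta> \<le> 1 \<and>
         (\<forall>(E::'a set) \<U>. finite E \<longrightarrow> right_uniform_covering \<U> \<longrightarrow> finite \<U> \<longrightarrow> card \<U> \<le> 3 \<longrightarrow>
           (\<exists>F. finite F \<and> F \<noteq> {} \<and>
             (\<forall>g\<in>E. real (matching_number F (left_translate g F) \<U>) \<ge> \<theta> * real (card F)))))) \<and>
     (amenable G \<longleftrightarrow>
       (\<exists>\<theta>::real. 0 < \<theta> \<and> \<theta> \<le> 1 \<and>
         (\<forall>(E::'a set) \<U>. finite E \<longrightarrow> right_uniform_covering \<U> \<longrightarrow> card \<U> = 2 \<longrightarrow>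
           (\<exists>F. finite F \<and> F \<noteq> {} \<and>
             (\<forall>g\<in>E. \<forall>h\<in>E.
               real (matching_number (left_translate g F) (left_translate h F) \<U>)
                 \<ge> \<theta> * real (card F))))))"
    (is "(_ \<longleftrightarrow> ?three) \<and> (_ \<longleftrightarrow> ?two)")
proof (intro conjI iffI)
  assume G: "amenable G"
  have "\<exists>F. finite F \<and> F \<noteq> {} \<and>
      (\<forall>g\<in>E. real (matching_number F (left_translate g F) \<U>) \<ge> 3/5 * real (card F))"
    if "finite E" "right_uniform_covering \<U>" "finite \<U>" "card \<U> \<le> 3" for E :: "'a set" and \<U>
  proof -
    have "left_translate 0 F = F" for F :: "'a set" by (simp add: left_translate_def)
    then show ?thesis
      using matchings_of_amenable[OF G that(2-4), of "insert 0 E"] that(1)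
      by (metis finite_insert insert_iff)
  qed
  then show ?three by (intro exI[of _ "3/5"]) simp
  have "\<exists>F. finite F \<and> F \<noteq> {} \<and> (\<forall>g\<in>E. \<forall>h\<in>E.
      real (matching_number (left_translate g F) (left_translate h F) \<U>) \<ge> 3/5 * real (card F))"
    if "finite E" "right_uniform_covering \<U>" "card \<U> = 2" for E :: "'a set" and \<U>
    using that by (intro matchings_of_amenable[OF G]) (auto intro: card_ge_0_finite)
  then show ?two by (intro exI[of _ "3/5"]) simp
next
  assume ?three
  then obtain \<theta> :: real where \<theta>: "1/2 < \<theta>" "\<theta> \<le> 1"
    and match: "\<And>(E::'a set) \<U>. finite E \<Longrightarrow> right_uniform_covering \<U> \<Longrightarrow> finite \<U> \<Longrightarrow> card \<U> \<le> 3 \<Longrightarrow>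
      \<exists>F. finite F \<and> F \<noteq> {} \<and>
        (\<forall>g\<in>E. real (matching_number F (left_translate g F) \<U>) \<ge> \<theta> * real (card F))"
    by blast
  show "amenable G"
    by (rule amenable_if_contracts_averages[OF _ _ contracts_averages_of_three_set_matchings[OF \<theta> match]]) (use \<theta> in auto)
next
  assume ?two
  then obtain \<theta> :: real where \<theta>: "0 < \<theta>" "\<theta> \<le> 1"
    and match: "\<And>(E::'a set) \<U>. finite E \<Longrightarrow> right_uniform_covering \<U> \<Longrightarrow> card \<U> = 2 \<Longrightarrow>
      \<exists>F. finite F \<and> F \<noteq> {} \<and> (\<forall>g\<in>E. \<forall>h\<in>E.
        real (matching_number (left_translate g F) (left_translate h F) \<U>) \<ge> \<theta> * real (card F))"
    by blast
  show "amenable G"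
    by (rule amenable_if_contracts_averages[OF _ _ contracts_averages_of_two_set_matchings[OF \<theta> match]]) (use \<theta> in auto)
qed

end
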